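(* Let $\nu>1$, $b>0$, $\alpha\in(0,1]$, $p\in(0,1)$. Each of the following processes is a Lévy process, with Lévy symbol $\eta_Y(u):=\frac1t\log\mathbb{E}e^{iuY(t)}$, $u\in\mathbb{R}$, as stated: (i) the fractional Gamma subordinator $\overline{\Gamma}_\nu(t)=\Gamma(\mathcal{A}_{1/\nu}(t))$, with $\Gamma$ of parameter $b$: $\eta_{\overline{\Gamma}_\nu}(u)=-\left[\log(1-iu/b)\right]^{1/\nu}$; (ii) the fractional Variance Gamma process $\overline{X}_\nu(t)=B(\overline{\Gamma}_\nu(t))$, with $\Gamma$ of parameter $1$: $\eta_{\overline{X}_\nu}(u)=-\left[\log\left(1+\frac{u^2}{2}\right)\right]^{1/\nu}$; (iii) the fractional Geometric Stable process $\overline{G}^\nu_\alpha(t)=\mathcal{A}_\alpha(\overline{\Gamma}_\nu(t))$, with $\Gamma$ of parameter $1$: $\eta_{\overline{G}^\nu_\alpha}(u)=-\left[\log\left(1+(-iu)^\alpha\right)\right]^{1/\nu}$; (iv) the fractional Negative Binomial process $\overline{M}_\nu(t)=N_1(\overline{\Gamma}_\nu(t))$, with $\Gamma$ of parameter $p/(1-p)$: $\eta_{\overline{M}_\nu}(u)=-\left[\log\frac{1-(1-p)e^{iu}}{p}\right]^{1/\nu}$.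
   Context: $\Gamma(t)$, $t\ge0$, is the Gamma subordinator with parameter $b>0$: $\Gamma(t)$ has density $\frac{b^t}{\Gamma(t)}x^{t-1}e^{-bx}$, $x\ge0$. $\mathcal{A}_\alpha$ is the stable subordinator of index $\alpha\in(0,1]$, with $\mathbb{E}e^{-k\mathcal{A}_\alpha(t)}=e^{-k^\alpha t}$, $k>0$. $B$ is a standard Brownian motion, $N_1$ a homogeneous Poisson process of intensity $1$. In each composition, all component processes are independent. Logarithms and powers of complex numbers are principal branches.
   Formalization: In the definition of the Lévy symbol, the log of E e^{iuY(t)} is taken as the continuous logarithm in u vanishing at u=0, not the principal branch, since with the principal branch the stated formulas fail for large t; logs and powers in the formulas for η remain principal. *)

theory Defs
  imports "HOL-Probability.Probability"
begin

definition cadlag :: "(real \<Rightarrow> real) \<Rightarrow> bool" where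
  "cadlag f \<longleftrightarrow>
     (\<forall>t\<ge>0. (f \<longlongrightarrow> f t) (at_right t)) \<and>
     (\<forall>t>0. \<exists>l. (f \<longlongrightarrow> l) (at_left t))"

text \<open>A process is a function \<open>X :: real \<Rightarrow> 'a \<Rightarrow> real\<close>; only its values at times \<open>t \<ge> 0\<close> matter.\<close>

context prob_space
begin

definition independent_increments :: "(real \<Rightarrow> 'a \<Rightarrow> real) \<Rightarrow> bool" where
  "independent_increments X \<longleftrightarrow>
     (\<forall>n. \<forall>t :: nat \<Rightarrow> real. 0 \<le> t 0 \<and> (\<forall>i<n. t i < t (Suc i)) \<longrightarrow>
        indep_vars (\<lambda>_. borel) (\<lambda>i \<omega>. X (t (Suc i)) \<omega> - X (t i) \<omega>) {..<n})"

definition stationary_increments :: "(real \<Rightarrow> 'a \<Rightarrow> real) \<Rightarrow> bool" where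
  "stationary_increments X \<longleftrightarrow>
     (\<forall>s\<ge>0. \<forall>t\<ge>0. distr M borel (\<lambda>\<omega>. X (s + t) \<omega> - X s \<omega>) = distr M borel (\<lambda>\<omega>. X t \<omega> - X 0 \<omega>))"

definition stochastically_continuous :: "(real \<Rightarrow> 'a \<Rightarrow> real) \<Rightarrow> bool" where
  "stochastically_continuous X \<longleftrightarrow>
     (\<forall>s\<ge>0. \<forall>\<epsilon>>0.
        ((\<lambda>t. prob {\<omega> \<in> space M. \<bar>X t \<omega> - X s \<omega>\<bar> > \<epsilon>}) \<longlongrightarrow> 0) (at s within {0..}))"

definition levy_process :: "(real \<Rightarrow> 'a \<Rightarrow> real) \<Rightarrow> bool" where
  "levy_process X \<longleftrightarrow>
     (\<forall>t\<ge>0. random_variable borel (X t)) \<and>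
     (AE \<omega> in M. X 0 \<omega> = 0) \<and>
     independent_increments X \<and>
     stationary_increments X \<and>
     stochastically_continuous X \<and>
     (AE \<omega> in M. cadlag (\<lambda>t. X t \<omega>))"

definition subordinator :: "(real \<Rightarrow> 'a \<Rightarrow> real) \<Rightarrow> bool" where
  "subordinator T \<longleftrightarrow> levy_process T \<and> (AE \<omega> in M. mono_on {0..} (\<lambda>t. T t \<omega>))"

definition gamma_subordinator :: "real \<Rightarrow> (real \<Rightarrow> 'a \<Rightarrow> real) \<Rightarrow> bool" where
  "gamma_subordinator b G \<longleftrightarrow> subordinator G \<and>
     (\<forall>t>0. distributed M lborel (G t)
        (\<lambda>x. ennreal (b powr t / Gamma t * x powr (t - 1) * exp (- b * x) * indicator {0..} x)))"

definition stable_subordinator :: "real \<Rightarrow> (real \<Rightarrow> 'a \<Rightarrow> real) \<Rightarrow> bool" where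
  "stable_subordinator \<alpha> A \<longleftrightarrow> subordinator A \<and>
     (\<forall>t\<ge>0. \<forall>k>0. expectation (\<lambda>\<omega>. exp (- k * A t \<omega>)) = exp (- (k powr \<alpha>) * t))"

definition brownian_motion :: "(real \<Rightarrow> 'a \<Rightarrow> real) \<Rightarrow> bool" where
  "brownian_motion B \<longleftrightarrow> levy_process B \<and>
     (AE \<omega> in M. continuous_on {0..} (\<lambda>t. B t \<omega>)) \<and>
     (\<forall>t>0. distributed M lborel (B t) (normal_density 0 (sqrt t)))"

definition poisson_process :: "real \<Rightarrow> (real \<Rightarrow> 'a \<Rightarrow> real) \<Rightarrow> bool" where
  "poisson_process r N \<longleftrightarrow> levy_process N \<and>
     (\<forall>t\<ge>0. \<forall>n::nat.
        prob {\<omega> \<in> space M. N t \<omega> = real n} = (r * t) ^ n / fact n * exp (- r * t))"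

text \<open>Joint independence of whole processes, as random elements of \<open>\<real>\<close> to the power \<open>[0,\<infinity>)\<close>
  with the product sigma-algebra.\<close>

definition indep_processes :: "(real \<Rightarrow> 'a \<Rightarrow> real) list \<Rightarrow> bool" where
  "indep_processes Xs \<longleftrightarrow>
     indep_vars (\<lambda>_. \<Pi>\<^sub>M t\<in>{0..}. borel) (\<lambda>i \<omega>. \<lambda>t\<in>{0..}. (Xs ! i) t \<omega>) {..<length Xs}"

end

text \<open>
  The defining properties of paths above hold only almost surely, so \<open>X (T t \<omega>) \<omega>\<close> need not be
  measurable with respect to \<open>M\<close>: on an exceptional null set the path of \<open>X\<close> is arbitrary. It is
  a random variable on \<open>completion M\<close>, which is \<open>M\<close> itself if the probability space is complete.
\<close>

definition time_change :: "(real \<Rightarrow> 'a \<Rightarrow> real) \<Rightarrow> (real \<Rightarrow> 'a \<Rightarrow> real) \<Rightarrow> real \<Rightarrow> 'a \<Rightarrow> real" where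
  "time_change X T = (\<lambda>t \<omega>. X (T t \<omega>) \<omega>)"

text \<open>
  The logarithm in the Levy symbol \<open>1/t log E e^{iuY(t)}\<close> has to be the distinguished logarithm
  of the characteristic function (continuous in \<open>u\<close>, zero at \<open>u = 0\<close>). With the principal branch
  the quotient would depend on \<open>t\<close>, because the imaginary part of \<open>t * \<eta> u\<close> leaves
  \<open>(-\<pi>, \<pi>]\<close> for large \<open>t\<close>.
\<close>

definition distinguished_log :: "(real \<Rightarrow> complex) \<Rightarrow> real \<Rightarrow> complex" where
  "distinguished_log \<phi> =
     (THE g. continuous_on UNIV g \<and> g 0 = 0 \<and> (\<forall>u. exp (g u) = \<phi> u))"

definition levy_symbol :: "'a measure \<Rightarrow> (real \<Rightarrow> 'a \<Rightarrow> real) \<Rightarrow> real \<Rightarrow> real \<Rightarrow> complex" where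
  "levy_symbol M Y t u =
     1 / of_real t * distinguished_log (\<lambda>v. LINT \<omega>|M. exp (\<i> * of_real v * of_real (Y t \<omega>))) u"

lemma distinguished_log_eqI:
  assumes g: "continuous_on UNIV g" "g 0 = 0" "\<And>u. exp (g u) = \<phi> u"
  shows "distinguished_log \<phi> = g"
  unfolding distinguished_log_def
proof (rule the_equality)
  show "continuous_on UNIV g \<and> g 0 = 0 \<and> (\<forall>u. exp (g u) = \<phi> u)"
    using g by blast
next
  fix h assume h: "continuous_on UNIV h \<and> h 0 = 0 \<and> (\<forall>u. exp (h u) = \<phi> u)"
  have ex: "\<exists>n::int. h u - g u = of_int (2 * n) * (of_real pi * \<i>)" for u
  proof -
    have "exp (h u) = exp (g u)" using h g(3) by simp
    then obtain n :: int where "h u = g u + (of_int (2 * n) * pi) * \<i>"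
      unfolding exp_eq by blast
    then show ?thesis by (intro exI[of _ n]) simp
  qed
  have "(\<lambda>u. h u - g u) constant_on UNIV"
  proof (rule continuous_discrete_range_constant)
    show "connected (UNIV :: real set)" by simp
    show "continuous_on UNIV (\<lambda>u. h u - g u)" using h g by (intro continuous_intros) auto
    fix u :: real
    have "2 * pi \<le> norm ((h v - g v) - (h u - g u))" if "h v - g v \<noteq> h u - g u" for v
    proof -
      obtain m where m: "h v - g v = of_int (2 * m) * (of_real pi * \<i>)" using ex by blast
      obtain n where n: "h u - g u = of_int (2 * n) * (of_real pi * \<i>)" using ex by blast
      have "m \<noteq> n" using that m n by auto
      then have "2 \<le> \<bar>2 * (m - n)\<bar>" by arith
      then have "2 \<le> \<bar>real_of_int (2 * (m - n))\<bar>" by linarith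
      then have "2 * pi \<le> \<bar>real_of_int (2 * (m - n))\<bar> * pi" by (intro mult_right_mono) auto
      moreover have "(h v - g v) - (h u - g u) = of_int (2 * (m - n)) * (of_real pi * \<i>)"
        unfolding m n by (simp add: algebra_simps)
      then have "norm ((h v - g v) - (h u - g u)) = \<bar>real_of_int (2 * (m - n))\<bar> * pi"
        by (simp only: norm_mult norm_of_int norm_of_real norm_ii) simp
      ultimately show ?thesis by simp
    qed
    then show "\<exists>e>0. \<forall>v. v \<in> UNIV \<and> h v - g v \<noteq> h u - g u \<longrightarrow> e \<le> norm ((h v - g v) - (h u - g u))"
      by (intro exI[of _ "2 * pi"]) auto
  qed
  then obtain c where c: "h u - g u = c" for u unfolding constant_on_def by blast
  have "c = 0" using c[of 0] h g(2) by simp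
  then show "h = g" using c by auto
qed

end

theory Submission
  imports Defs "HOL-Complex_Analysis.Complex_Analysis"
begin

text \<open>
  Each statement is an instance of two principles about time changes of a Levy process \<open>X\<close> by
  an independent subordinator \<open>T\<close>: the composition is again a Levy process, and if
  \<open>E exp (i u X(s)) = exp (- s w(u))\<close>, then the exponent of \<open>X(T(t))\<close> arises by inserting \<open>w(u)\<close>
  into the Laplace exponent of \<open>T\<close>. Since \<open>X(G(A(t)))\<close> is the process \<open>X(G(s))\<close> evaluated at
  \<open>s = A(t)\<close>, the principles are applied first to \<open>(X, G)\<close> and then to the resulting process
  and \<open>A\<close>.

  Both principles come from Fubini's theorem: given the path of \<open>T\<close>, the increments of \<open>X(T(t))\<close>
  are increments of \<open>X\<close> over fixed times
  (\<open>emeasure_subordinate_increments\<close>, \<open>expectation_subordinate\<close>), so their joint law is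
  \<open>E (\<Prod>\<^sub>i h\<^sub>i(T(t\<^sub>i\<^sub>+\<^sub>1) - T(t\<^sub>i)))\<close> with \<open>h\<^sub>i(r)\<close> a probability for \<open>X(r) - X(0)\<close>, and independence
  and stationarity of the increments of \<open>T\<close> pass to the composition
  (\<open>levy_process_subordinate\<close>). Independence is a statement about the product
  sigma-algebra on path space, where evaluation at a random time is not measurable. Such
  evaluations are therefore replaced by the functional \<open>path_at\<close>, a limit of evaluations at countably many times
  which agrees with the evaluation on right-continuous paths. The regularised process so obtained
  is measurable for the original sigma-algebra and indistinguishable from the time change;
  only at the end is the Levy property carried over to the completion
  (\<open>levy_process_completion\<close>).

  Laplace exponents are needed at complex arguments with nonnegative real part, whereas the
  stable subordinator is characterised by real positive arguments. The identity theorem extends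
  them to the open half-plane, and dominated convergence to its boundary
  (\<open>laplace_transform_continuation\<close>); the boundary matters because the characteristic function
  is the Laplace transform on the imaginary axis. The exponents at hand stay in the
  half-plane: if \<open>Re z \<ge> 0\<close> then \<open>Re (Ln (1 + z / b)) \<ge> 0\<close>. The resulting symbols are continuous
  in \<open>u\<close> and vanish at \<open>u = 0\<close>, which identifies them as distinguished logarithms divided by \<open>t\<close>.
\<close>

section \<open>Evaluating a right-continuous path at a random time\<close>

text \<open>The points lie strictly to the right of \<open>s\<close>, so that for a right-continuous path the values there
converge to the value at \<open>s\<close>.\<close>
definition grid :: "nat \<Rightarrow> real \<Rightarrow> real" where
  "grid n s = (real_of_int \<lfloor>real (Suc n) * s\<rfloor> + 1) / real (Suc n)"

lemma grid_bounds: "s < grid n s" "grid n s \<le> s + 1 / real (Suc n)"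
proof -
  have "real (Suc n) * s < real_of_int \<lfloor>real (Suc n) * s\<rfloor> + 1" by linarith
  then show "s < grid n s" unfolding grid_def by (subst pos_less_divide_eq) (auto simp: mult.commute)
  have "real_of_int \<lfloor>real (Suc n) * s\<rfloor> \<le> real (Suc n) * s" by linarith
  then have "grid n s \<le> (real (Suc n) * s + 1) / real (Suc n)"
    unfolding grid_def by (intro divide_right_mono) auto
  then show "grid n s \<le> s + 1 / real (Suc n)" by (simp add: add_divide_distrib)
qed

lemma filterlim_grid: "filterlim (\<lambda>n. grid n s) (at_right s) sequentially"
  unfolding filterlim_at
proof
  show "\<forall>\<^sub>F n in sequentially. grid n s \<in> {s<..} \<and> grid n s \<noteq> s"
  proof (intro always_eventually allI)
    fix n show "grid n s \<in> {s<..} \<and> grid n s \<noteq> s" using grid_bounds(1)[of s n] by simp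
  qed
  have lim: "(\<lambda>n. s + 1 / real (Suc n)) \<longlonglongrightarrow> s"
    using tendsto_add[OF tendsto_const LIMSEQ_Suc[OF lim_1_over_n], of s] by simp
  show "(\<lambda>n. grid n s) \<longlonglongrightarrow> s"
  proof (rule tendsto_sandwich[OF _ _ tendsto_const lim]; intro always_eventually allI)
    fix n
    show "s \<le> grid n s" using grid_bounds(1)[of s n] by simp
    show "grid n s \<le> s + 1 / real (Suc n)" by (rule grid_bounds(2))
  qed
qed

text \<open>The truncation \<open>max 0 s\<close> keeps all evaluation points in the index set of \<open>path_space\<close>, also on the
null set where a subordinator takes negative values.\<close>
definition path_at :: "(real \<Rightarrow> real) \<Rightarrow> real \<Rightarrow> real" where
  "path_at x s = lim (\<lambda>n. x (grid n (max 0 s)))"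

abbreviation path_space :: "(real \<Rightarrow> real) measure" where
  "path_space \<equiv> \<Pi>\<^sub>M t\<in>{0..}. borel"

lemma path_at_eq:
  assumes "0 \<le> s" "(x \<longlongrightarrow> x s) (at_right s)"
  shows "path_at x s = x s"
  unfolding path_at_def using assms
  by (auto intro!: limI filterlim_compose[OF _ filterlim_grid] simp: max_def)

text \<open>The evaluation points form a countable set for each \<open>n\<close>, so every approximation is a countable
case distinction between coordinate projections.\<close>
lemma measurable_path_at[measurable (raw)]:
  assumes f: "f \<in> N \<rightarrow>\<^sub>M path_space" and g: "g \<in> borel_measurable N"
  shows "(\<lambda>\<omega>. path_at (f \<omega>) (g \<omega>)) \<in> borel_measurable N"
proof -
  note [measurable] = f g
  have "(\<lambda>\<omega>. f \<omega> (grid n (max 0 (g \<omega>)))) \<in> borel_measurable N" for n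
  proof -
    let ?k = "\<lambda>\<omega>. nat \<lfloor>real (Suc n) * max 0 (g \<omega>)\<rfloor>"
    have *: "(\<lambda>\<omega>. f \<omega> ((real k + 1) / real (Suc n))) \<in> borel_measurable N" for k
      by (rule measurable_compose[OF f measurable_component_singleton]) auto
    have "(\<lambda>\<omega>. f \<omega> ((real (?k \<omega>) + 1) / real (Suc n))) \<in> borel_measurable N"
      by (rule measurable_compose_countable[OF *]) measurable
    then show ?thesis by (simp add: grid_def)
  qed
  then show ?thesis unfolding path_at_def by measurable
qed

lemma cadlag_cong:
  assumes "cadlag f" "\<And>t. 0 \<le> t \<Longrightarrow> f t = g t"
  shows "cadlag g"
  unfolding cadlag_def
proof safe
  fix t :: real assume t: "0 \<le> t"
  have "\<forall>\<^sub>F u in at_right t. f u = g u"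
    using t assms(2) by (auto simp: eventually_at_filter intro!: always_eventually)
  then show "(g \<longlongrightarrow> g t) (at_right t)"
    using assms t unfolding cadlag_def by (auto intro: Lim_transform_eventually)
next
  fix t :: real assume t: "0 < t"
  then obtain l where l: "(f \<longlongrightarrow> l) (at_left t)" using assms unfolding cadlag_def by blast
  have "\<forall>\<^sub>F u in at_left t. f u = g u"
    using eventually_at_left_real[OF t] by eventually_elim (auto intro: assms)
  then show "\<exists>l. (g \<longlongrightarrow> l) (at_left t)" using l by (auto intro: Lim_transform_eventually)
qed

text \<open>For left limits, \<open>g\<close> either reaches its left limit \<open>l\<close> before \<open>t\<close> and is then constant up to \<open>t\<close>, or
it approaches \<open>l\<close> strictly from below. Monotonicity excludes any oscillation around \<open>l\<close>, where the
one-sided limits of \<open>f\<close> may differ.\<close>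
lemma cadlag_compose:
  assumes f: "cadlag f" and g: "cadlag g" "mono_on {0..} g" "g 0 = 0"
  shows "cadlag (\<lambda>t. f (g t))"
  unfolding cadlag_def
proof safe
  have nonneg: "0 \<le> g t" if "0 \<le> t" for t
    using mono_onD[OF g(2), of 0 t] g(3) that by simp
  { fix t :: real assume t: "0 \<le> t"
    show "((\<lambda>u. f (g u)) \<longlongrightarrow> f (g t)) (at_right t)"
    proof (rule tendstoI)
      fix e :: real assume e: "0 < e"
      have "(f \<longlongrightarrow> f (g t)) (at_right (g t))"
        using f nonneg[OF t] by (auto simp: cadlag_def)
      from tendstoD[OF this e] obtain b where
        b: "b > g t" "\<And>y. g t < y \<Longrightarrow> y < b \<Longrightarrow> dist (f y) (f (g t)) < e"
        by (auto simp: eventually_at_right_field)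
      have "(g \<longlongrightarrow> g t) (at_right t)" using g t by (auto simp: cadlag_def)
      then have "\<forall>\<^sub>F u in at_right t. g u < b" using b(1) by (rule order_tendstoD)
      moreover have "\<forall>\<^sub>F u in at_right t. t < u" by (simp add: eventually_at_filter)
      ultimately show "\<forall>\<^sub>F u in at_right t. dist (f (g u)) (f (g t)) < e"
      proof eventually_elim
        case (elim u)
        have "g t \<le> g u" using mono_onD[OF g(2), of t u] elim t by auto
        then show ?case using b(2)[of "g u"] elim e by (cases "g u = g t") auto
      qed
    qed
  }
  { fix t :: real assume t: "0 < t"
    then obtain l where l: "(g \<longlongrightarrow> l) (at_left t)" using g by (auto simp: cadlag_def)
    have le: "g u \<le> l" if "0 \<le> u" "u < t" for u
    proof (rule tendsto_lowerbound[OF l])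
      have "\<forall>\<^sub>F v in at_left t. v \<in> {u<..<t}" by (rule eventually_at_left_real[OF that(2)])
      then show "\<forall>\<^sub>F v in at_left t. g u \<le> g v"
        by eventually_elim (use that mono_onD[OF g(2)] in auto)
    qed simp
    show "\<exists>l. ((\<lambda>u. f (g u)) \<longlongrightarrow> l) (at_left t)"
    proof (cases "\<exists>u\<ge>0. u < t \<and> g u = l")
      case True
      then obtain u where u: "0 \<le> u" "u < t" "g u = l" by blast
      have "\<forall>\<^sub>F v in at_left t. v \<in> {u<..<t}" by (rule eventually_at_left_real[OF u(2)])
      then have "\<forall>\<^sub>F v in at_left t. f l = f (g v)"
      proof eventually_elim
        case (elim v)
        then show ?case using le[of v] mono_onD[OF g(2), of u v] u by (auto intro: arg_cong[of _ _ f])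
      qed
      then show ?thesis by (intro exI[of _ "f l"]) (auto intro: Lim_transform_eventually)
    next
      case False
      then have lt: "g u < l" if "0 \<le> u" "u < t" for u
        using le[of u] that by (auto simp: less_le)
      have "0 < l" using lt[of 0] t g(3) by simp
      then obtain m where m: "(f \<longlongrightarrow> m) (at_left l)" using f by (auto simp: cadlag_def)
      have "\<forall>\<^sub>F v in at_left t. g v \<in> {..<l} \<and> g v \<noteq> l"
        using eventually_at_left_real[OF t]
      proof eventually_elim
        case (elim v)
        then have "g v < l" using lt by simp
        then show ?case by simp
      qed
      then have "filterlim g (at_left l) (at_left t)" using l by (simp add: filterlim_at)
      from filterlim_compose[OF m this] show ?thesis by blast
    qed
  }
qed

definition sample_path :: "(real \<Rightarrow> 'a \<Rightarrow> real) \<Rightarrow> 'a \<Rightarrow> real \<Rightarrow> real" where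
  "sample_path X \<omega> = (\<lambda>t\<in>{0..}. X t \<omega>)"

text \<open>A version of \<open>time_change X T\<close> that is a measurable function of the two sample paths.\<close>
definition subordinate :: "(real \<Rightarrow> 'a \<Rightarrow> real) \<Rightarrow> (real \<Rightarrow> 'a \<Rightarrow> real) \<Rightarrow> real \<Rightarrow> 'a \<Rightarrow> real" where
  "subordinate X T t \<omega> = path_at (sample_path X \<omega>) (T t \<omega>)"

lemma path_at_path:
  assumes "cadlag (\<lambda>t. X t \<omega>)" "0 \<le> s"
  shows "path_at (sample_path X \<omega>) s = X s \<omega>"
proof -
  have "cadlag (sample_path X \<omega>)" by (rule cadlag_cong[OF assms(1)]) (simp add: sample_path_def)
  then have "path_at (sample_path X \<omega>) s = sample_path X \<omega> s"
    using assms by (intro path_at_eq) (auto simp: cadlag_def)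
  then show ?thesis using assms by (simp add: sample_path_def)
qed

section \<open>Subordination of Levy processes\<close>

context prob_space
begin

lemma measurable_path[measurable (raw)]:
  assumes "\<And>t. 0 \<le> t \<Longrightarrow> X t \<in> borel_measurable M"
  shows "sample_path X \<in> M \<rightarrow>\<^sub>M path_space"
  unfolding sample_path_def[abs_def] using assms by (intro measurable_restrict) auto

text \<open>Independence of increments is defined for strictly increasing times, but a subordinator may stay
constant on an interval. A repeated time contributes the zero increment, hence a factor
\<open>0\<close> or \<open>1\<close>, and can be removed from the list; \<open>e\<close> below enumerates the remaining indices.\<close>
lemma levy_increments_prob:
  assumes X: "levy_process X"
    and "0 \<le> s 0" "\<And>i. i < n \<Longrightarrow> s i \<le> s (Suc i)" "\<And>i. i < n \<Longrightarrow> B i \<in> sets borel"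
  shows "prob {\<omega>\<in>space M. \<forall>i<n. X (s (Suc i)) \<omega> - X (s i) \<omega> \<in> B i} =
    (\<Prod>i<n. prob {\<omega>\<in>space M. X (s (Suc i) - s i) \<omega> - X 0 \<omega> \<in> B i})"
  using assms(2-)
proof (induction n arbitrary: s B)
  case 0
  then show ?case by (simp add: prob_space)
next
  case (Suc m)
  have X_meas[measurable]: "X t \<in> borel_measurable M" if "0 \<le> t" for t
    using X that by (auto simp: levy_process_def)
  show ?case
  proof (cases "\<forall>i<Suc m. s i < s (Suc i)")
    case True
    have nonneg: "0 \<le> s i" if "i \<le> Suc m" for i
      using that
    proof (induction i)
      case (Suc i) then show ?case using Suc.prems True by (force dest: spec[of _ i])
    qed (use Suc.prems in simp)
    have ind: "indep_vars (\<lambda>_. borel) (\<lambda>i \<omega>. X (s (Suc i)) \<omega> - X (s i) \<omega>) {..<Suc m}"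
      using X Suc.prems(1) True unfolding levy_process_def independent_increments_def by blast
    have law: "prob ((\<lambda>\<omega>. X (s (Suc i)) \<omega> - X (s i) \<omega>) -` B i \<inter> space M) =
        prob {\<omega>\<in>space M. X (s (Suc i) - s i) \<omega> - X 0 \<omega> \<in> B i}" if i: "i < Suc m" for i
    proof -
      have "stationary_increments X" using X by (simp add: levy_process_def)
      moreover have "0 \<le> s i" "0 \<le> s (Suc i) - s i" using nonneg[of i] Suc.prems(2)[OF i] i by auto
      ultimately have "distr M borel (\<lambda>\<omega>. X (s i + (s (Suc i) - s i)) \<omega> - X (s i) \<omega>) =
          distr M borel (\<lambda>\<omega>. X (s (Suc i) - s i) \<omega> - X 0 \<omega>)"
        unfolding stationary_increments_def by blast
      then have "measure (distr M borel (\<lambda>\<omega>. X (s (Suc i)) \<omega> - X (s i) \<omega>)) (B i) =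
          measure (distr M borel (\<lambda>\<omega>. X (s (Suc i) - s i) \<omega> - X 0 \<omega>)) (B i)" by simp
      moreover have [measurable]: "X (s i) \<in> borel_measurable M" "X (s (Suc i)) \<in> borel_measurable M"
         "X (s (Suc i) - s i) \<in> borel_measurable M"  "X 0 \<in> borel_measurable M"
        using nonneg[of i] nonneg[of "Suc i"] Suc.prems(2)[OF i] i by auto
      ultimately show ?thesis using Suc.prems(3)[OF i]
        by (simp add: measure_distr vimage_def Int_def conj_commute)
    qed
    have "{\<omega>\<in>space M. \<forall>i<Suc m. X (s (Suc i)) \<omega> - X (s i) \<omega> \<in> B i} =
        (\<Inter>i\<in>{..<Suc m}. (\<lambda>\<omega>. X (s (Suc i)) \<omega> - X (s i) \<omega>) -` B i \<inter> space M)"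
      by (force simp: lessThan_empty_iff)
    also have "prob \<dots> = (\<Prod>i<Suc m. prob ((\<lambda>\<omega>. X (s (Suc i)) \<omega> - X (s i) \<omega>) -` B i \<inter> space M))"
      using Suc.prems(3) by (intro indep_varsD_finite[OF ind]) auto
    also have "\<dots> = (\<Prod>i<Suc m. prob {\<omega>\<in>space M. X (s (Suc i) - s i) \<omega> - X 0 \<omega> \<in> B i})"
      by (intro prod.cong refl law) simp
    finally show ?thesis .
  next
    case False
    then obtain k where k: "k < Suc m" "s (Suc k) = s k" using Suc.prems(2) by (force simp: not_less)
    define e where "e i = (if i < k then i else Suc i)" for i
    define s' where "s' i = (if i \<le> k then s i else s (Suc i))" for i
    have s': "s' i = s (e i)" and s'_Suc: "s' (Suc i) = s (Suc (e i))" for i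
      using k(2) by (cases "i = k"; auto simp: s'_def e_def)+
    have bij: "bij_betw e {..<m} ({..<Suc m} - {k})"
      by (rule bij_betwI[where g = "\<lambda>j. if j < k then j else j - 1"]) (use k in \<open>auto simp: e_def split: if_splits\<close>)
    have ball: "(\<forall>i<Suc m. P i) \<longleftrightarrow> P k \<and> (\<forall>i<m. P (e i))" for P
    proof -
      have "(\<forall>i<Suc m. P i) \<longleftrightarrow> P k \<and> (\<forall>i\<in>{..<Suc m} - {k}. P i)" using k(1) by auto
      also have "{..<Suc m} - {k} = e ` {..<m}" using bij by (simp add: bij_betw_def)
      finally show ?thesis by auto
    qed
    have e_less: "e i < Suc m" if "i < m" for i using that by (auto simp: e_def)
    have IH: "prob {\<omega>\<in>space M. \<forall>i<m. X (s' (Suc i)) \<omega> - X (s' i) \<omega> \<in> B (e i)} =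
        (\<Prod>i<m. prob {\<omega>\<in>space M. X (s' (Suc i) - s' i) \<omega> - X 0 \<omega> \<in> B (e i)})"
    proof (rule Suc.IH)
      show "0 \<le> s' 0" using Suc.prems(1) by (simp add: s'_def)
    next
      fix i assume "i < m"
      then show "s' i \<le> s' (Suc i)" "B (e i) \<in> sets borel"
        unfolding s'_Suc s'[of i] using Suc.prems(2,3)[OF e_less] by auto
    qed
    have "prob {\<omega>\<in>space M. \<forall>i<Suc m. X (s (Suc i)) \<omega> - X (s i) \<omega> \<in> B i} =
       prob {\<omega>\<in>space M. 0 \<in> B k \<and> (\<forall>i<m. X (s' (Suc i)) \<omega> - X (s' i) \<omega> \<in> B (e i))}"
      unfolding s'_Suc unfolding s' ball[of "\<lambda>i. X (s (Suc i)) _ - X (s i) _ \<in> B i"] by (simp add: k(2))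
    also have "\<dots> = indicator (B k) 0 * prob {\<omega>\<in>space M. \<forall>i<m. X (s' (Suc i)) \<omega> - X (s' i) \<omega> \<in> B (e i)}"
      by (cases "0 \<in> B k") auto
    also have "\<dots> = prob {\<omega>\<in>space M. X (s (Suc k) - s k) \<omega> - X 0 \<omega> \<in> B k} *
        (\<Prod>i<m. prob {\<omega>\<in>space M. X (s (Suc (e i)) - s (e i)) \<omega> - X 0 \<omega> \<in> B (e i)})"
      unfolding IH unfolding s'_Suc unfolding s' by (cases "0 \<in> B k") (auto simp: k(2) prob_space)
    also have "(\<Prod>i<m. prob {\<omega>\<in>space M. X (s (Suc (e i)) - s (e i)) \<omega> - X 0 \<omega> \<in> B (e i)}) =
        (\<Prod>i\<in>{..<Suc m} - {k}. prob {\<omega>\<in>space M. X (s (Suc i) - s i) \<omega> - X 0 \<omega> \<in> B i})"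
      by (rule prod.reindex_bij_betw[OF bij])
    also have "prob {\<omega>\<in>space M. X (s (Suc k) - s k) \<omega> - X 0 \<omega> \<in> B k} * \<dots> =
        (\<Prod>i<Suc m. prob {\<omega>\<in>space M. X (s (Suc i) - s i) \<omega> - X 0 \<omega> \<in> B i})"
      by (rule prod.remove[symmetric]) (use k in auto)
    finally show ?thesis .
  qed
qed

text \<open>Defined on path space rather than on \<open>M\<close>, so that measurability in \<open>r\<close> is part of Fubini's
theorem; \<open>increment_law_eq\<close> gives the probabilistic meaning.\<close>
definition increment_law :: "(real \<Rightarrow> 'a \<Rightarrow> real) \<Rightarrow> real set \<Rightarrow> real \<Rightarrow> ennreal" where
  "increment_law X B r =
     emeasure (distr M path_space (sample_path X)) {x \<in> space path_space. path_at x r - path_at x 0 \<in> B}"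

lemma levy_processD:
  assumes "levy_process X"
  shows "0 \<le> t \<Longrightarrow> X t \<in> borel_measurable M" "AE \<omega> in M. X 0 \<omega> = 0"
    "AE \<omega> in M. cadlag (\<lambda>t. X t \<omega>)" "sample_path X \<in> M \<rightarrow>\<^sub>M path_space"
  using assms by (auto simp: levy_process_def intro!: measurable_path)

lemma increment_law_measurable[measurable]:
  assumes X: "levy_process X" and B[measurable]: "B \<in> sets borel"
  shows "increment_law X B \<in> borel_measurable borel"
proof -
  let ?P = "distr M path_space (sample_path X)"
  interpret P: prob_space ?P by (rule prob_space_distr) (rule levy_processD[OF X])
  have "{p \<in> space (borel \<Otimes>\<^sub>M path_space). path_at (snd p) (fst p) - path_at (snd p) 0 \<in> B}
      \<in> sets (borel \<Otimes>\<^sub>M path_space)" (is "?Q \<in> _") by measurable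
  then have "?Q \<in> sets (borel \<Otimes>\<^sub>M ?P)" by simp
  from P.measurable_emeasure_Pair[OF this] show ?thesis
    by (simp add: increment_law_def[abs_def] space_pair_measure vimage_def)
qed

lemma increment_law_eq:
  assumes X: "levy_process X" and [measurable]: "B \<in> sets borel" and r: "0 \<le> r"
  shows "increment_law X B r = emeasure M {\<omega>\<in>space M. X r \<omega> - X 0 \<omega> \<in> B}"
proof -
  note [measurable] = levy_processD(4)[OF X] levy_processD(1)[OF X r] levy_processD(1)[OF X order_refl]
  have "{x \<in> space path_space. path_at x r - path_at x 0 \<in> B} \<in> sets path_space" by measurable
  then have "increment_law X B r = emeasure M (sample_path X -` {x \<in> space path_space. path_at x r - path_at x 0 \<in> B} \<inter> space M)"
    unfolding increment_law_def by (intro emeasure_distr) measurable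
  also have "\<dots> = emeasure M {\<omega>\<in>space M. path_at (sample_path X \<omega>) r - path_at (sample_path X \<omega>) 0 \<in> B}"
    using measurable_space[OF levy_processD(4)[OF X]] by (intro arg_cong[where f="emeasure M"]) auto
  also have "\<dots> = emeasure M {\<omega>\<in>space M. X r \<omega> - X 0 \<omega> \<in> B}"
  proof (rule emeasure_eq_AE)
    show "AE \<omega> in M. \<omega> \<in> {\<omega>\<in>space M. path_at (sample_path X \<omega>) r - path_at (sample_path X \<omega>) 0 \<in> B} \<longleftrightarrow>
        \<omega> \<in> {\<omega>\<in>space M. X r \<omega> - X 0 \<omega> \<in> B}"
      using levy_processD(3)[OF X] by eventually_elim (simp add: path_at_path r)
  qed measurable
  finally show ?thesis .
qed

lemma subordinator_paths:
  assumes "subordinator T"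
  shows "AE \<omega> in M. cadlag (\<lambda>t. T t \<omega>) \<and> mono_on {0..} (\<lambda>t. T t \<omega>) \<and> T 0 \<omega> = 0 \<and> (\<forall>t\<ge>0. 0 \<le> T t \<omega>)"
proof -
  have "levy_process T" "AE \<omega> in M. mono_on {0..} (\<lambda>t. T t \<omega>)"
    using assms by (auto simp: subordinator_def)
  from levy_processD(2,3)[OF this(1)] this(2) show ?thesis
    by eventually_elim (metis atLeast_iff mono_onD order_refl)
qed

lemma nonneg_subordinator:
  assumes "subordinator T" "0 \<le> t"
  shows "T t \<in> borel_measurable M" "AE \<omega> in M. 0 \<le> T t \<omega>"
proof -
  show "T t \<in> borel_measurable M"
    using assms by (auto simp: subordinator_def levy_processD)
  show "AE \<omega> in M. 0 \<le> T t \<omega>"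
    using subordinator_paths[OF assms(1)] by eventually_elim (use assms(2) in blast)
qed

lemma subordinate_AE_eq:
  assumes X: "levy_process X" and T: "subordinator T"
  shows "AE \<omega> in M. \<forall>t\<ge>0. subordinate X T t \<omega> = X (T t \<omega>) \<omega>"
  using levy_processD(3)[OF X] subordinator_paths[OF T]
  by eventually_elim (simp add: subordinate_def path_at_path)

lemma subordinate_measurable:
  assumes X: "levy_process X" and T: "subordinator T" and t: "0 \<le> t"
  shows "subordinate X T t \<in> borel_measurable M"
proof -
  have [measurable]: "T t \<in> borel_measurable M"
    using T t by (auto simp: subordinator_def levy_processD)
  note [measurable] = levy_processD(4)[OF X]
  show ?thesis unfolding subordinate_def[abs_def] by measurable
qed

text \<open>By independence the joint law of the two paths is a product measure, so the path of \<open>T\<close> can be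
frozen in the inner integral. What remains there is the joint law of increments of \<open>X\<close> over fixed times.\<close>
lemma emeasure_subordinate_increments:
  assumes X: "levy_process X" and T: "subordinator T"
    and ind: "indep_var path_space (sample_path X) path_space (sample_path T)"
    and t: "0 \<le> t 0" "\<And>i. i < n \<Longrightarrow> t i \<le> t (Suc i)" and B[measurable]: "\<And>i. B i \<in> sets borel"
  shows "emeasure M {\<omega>\<in>space M. \<forall>i<n. subordinate X T (t (Suc i)) \<omega> - subordinate X T (t i) \<omega> \<in> B i} =
    (\<integral>\<^sup>+\<omega>. (\<Prod>i<n. increment_law X (B i) (T (t (Suc i)) \<omega> - T (t i) \<omega>)) \<partial>M)"
proof -
  let ?PX = "distr M path_space (sample_path X)" and ?PT = "distr M path_space (sample_path T)"
  have LT: "levy_process T" using T by (simp add: subordinator_def)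
  note [measurable] = levy_processD(4)[OF X] levy_processD(4)[OF LT]
  note XM = levy_processD(1)[OF X]
  interpret PX: prob_space ?PX by (rule prob_space_distr) measurable
  interpret PT: prob_space ?PT by (rule prob_space_distr) measurable
  interpret PP: pair_prob_space ?PX ?PT ..
  have t_nonneg: "0 \<le> t i" if "i \<le> n" for i
    using that
  proof (induction i)
    case (Suc i) then show ?case using t(2)[of i] by simp
  qed (use t in simp)
  define Q where "Q x \<tau> \<longleftrightarrow> (\<forall>i<n. path_at x (\<tau> (t (Suc i))) - path_at x (\<tau> (t i)) \<in> B i)" for x \<tau>
  define A where "A = {p \<in> space (path_space \<Otimes>\<^sub>M path_space). Q (fst p) (snd p)}"
  have coord: "(\<lambda>p. snd p (t i)) \<in> borel_measurable (path_space \<Otimes>\<^sub>M path_space)"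
    if "i \<le> n" for i
    using t_nonneg[OF that] by (intro measurable_compose[OF measurable_snd measurable_component_singleton]) auto
  have "{p \<in> space (path_space \<Otimes>\<^sub>M path_space). \<forall>i\<in>{..<n}.
      path_at (fst p) (snd p (t (Suc i))) - path_at (fst p) (snd p (t i)) \<in> B i} \<in> sets (path_space \<Otimes>\<^sub>M path_space)"
  proof (rule sets.sets_Collect_finite_All)
    fix i assume i: "i \<in> {..<n}"
    then have "i \<le> n" "Suc i \<le> n" by auto
    note [measurable] = coord[OF this(1)] coord[OF this(2)]
    show "{p \<in> space (path_space \<Otimes>\<^sub>M path_space).
      path_at (fst p) (snd p (t (Suc i))) - path_at (fst p) (snd p (t i)) \<in> B i} \<in> sets (path_space \<Otimes>\<^sub>M path_space)"
      by measurable
  qed simp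
  then have A[measurable]: "A \<in> sets (path_space \<Otimes>\<^sub>M path_space)"
    by (simp only: A_def Q_def Ball_def lessThan_iff)
  have "{x \<in> space path_space. \<forall>i\<in>{..<n}. path_at x (\<tau> (t (Suc i))) - path_at x (\<tau> (t i)) \<in> B i}
      \<in> sets path_space" for \<tau>
  proof (rule sets.sets_Collect_finite_All)
    fix i
    have "(\<lambda>x. path_at x (\<tau> (t (Suc i))) - path_at x (\<tau> (t i))) \<in> borel_measurable path_space"
      by (intro borel_measurable_diff measurable_path_at) auto
    from measurable_sets_Collect[OF this] B
    show "{x \<in> space path_space. path_at x (\<tau> (t (Suc i))) - path_at x (\<tau> (t i)) \<in> B i} \<in> sets path_space"
      by simp
  qed simp
  then have sect[measurable]: "{x \<in> space path_space. Q x \<tau>} \<in> sets path_space" for \<tau>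
    by (simp only: Q_def Ball_def lessThan_iff)
  have "emeasure M {\<omega>\<in>space M. \<forall>i<n. subordinate X T (t (Suc i)) \<omega> - subordinate X T (t i) \<omega> \<in> B i} =
      emeasure M ((\<lambda>\<omega>. (sample_path X \<omega>, sample_path T \<omega>)) -` A \<inter> space M)"
    using measurable_space[OF levy_processD(4)[OF X]] measurable_space[OF levy_processD(4)[OF LT]] t_nonneg
    by (intro arg_cong[where f="emeasure M"])
       (auto simp: A_def Q_def space_pair_measure subordinate_def sample_path_def)
  also have "\<dots> = emeasure (distr M (path_space \<Otimes>\<^sub>M path_space) (\<lambda>\<omega>. (sample_path X \<omega>, sample_path T \<omega>))) A"
    by (rule emeasure_distr[symmetric]) measurable
  also have "distr M (path_space \<Otimes>\<^sub>M path_space) (\<lambda>\<omega>. (sample_path X \<omega>, sample_path T \<omega>)) = ?PX \<Otimes>\<^sub>M ?PT"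
    using ind by (simp add: indep_var_distribution_eq)
  also have "emeasure (?PX \<Otimes>\<^sub>M ?PT) A = (\<integral>\<^sup>+\<tau>. emeasure ?PX ((\<lambda>x. (x, \<tau>)) -` A) \<partial>?PT)"
    using A by (intro PP.emeasure_pair_measure_alt2) simp
  finally have 1: "emeasure M {\<omega>\<in>space M. \<forall>i<n. subordinate X T (t (Suc i)) \<omega> - subordinate X T (t i) \<omega> \<in> B i} =
      (\<integral>\<^sup>+\<tau>. emeasure ?PX ((\<lambda>x. (x, \<tau>)) -` A) \<partial>?PT)" .
  have 2: "(\<integral>\<^sup>+\<tau>. emeasure ?PX ((\<lambda>x. (x, \<tau>)) -` A) \<partial>?PT) =
      (\<integral>\<^sup>+\<omega>. emeasure ?PX ((\<lambda>x. (x, sample_path T \<omega>)) -` A) \<partial>M)"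
  proof (rule nn_integral_distr)
    have "A \<in> sets (?PX \<Otimes>\<^sub>M ?PT)" using A by simp
    from PP.measurable_emeasure_Pair2[OF this]
    show "(\<lambda>\<tau>. emeasure ?PX ((\<lambda>x. (x, \<tau>)) -` A)) \<in> borel_measurable ?PT" .
  qed (rule levy_processD(4)[OF LT])
  have 3: "(\<integral>\<^sup>+\<omega>. emeasure ?PX ((\<lambda>x. (x, sample_path T \<omega>)) -` A) \<partial>M) =
      (\<integral>\<^sup>+\<omega>. (\<Prod>i<n. increment_law X (B i) (T (t (Suc i)) \<omega> - T (t i) \<omega>)) \<partial>M)"
  proof (rule nn_integral_cong_AE)
    show "AE \<omega> in M. emeasure ?PX ((\<lambda>x. (x, sample_path T \<omega>)) -` A) =
       (\<Prod>i<n. increment_law X (B i) (T (t (Suc i)) \<omega> - T (t i) \<omega>))"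
      using subordinator_paths[OF T] AE_space
    proof eventually_elim
      case (elim \<omega>)
      define s where "s i = T (t i) \<omega>" for i
      have s_mono: "s i \<le> s (Suc i)" if "i < n" for i
      proof -
        have "0 \<le> t i" "t i \<le> t (Suc i)" using t_nonneg[of i] t(2)[OF that] that by auto
        then show ?thesis unfolding s_def using mono_onD[of "{0..}" "\<lambda>t. T t \<omega>" "t i" "t (Suc i)"] elim(1) by simp
      qed
      have s_nonneg: "0 \<le> s i" if "i \<le> n" for i
        unfolding s_def using elim(1) t_nonneg[OF that] by blast
      have [measurable]: "X (s i) \<in> borel_measurable M" if "i \<le> n" for i
        using s_nonneg[OF that] by (rule XM)
      have slice: "(\<lambda>x. (x, sample_path T \<omega>)) -` A = {x \<in> space path_space. Q x (sample_path T \<omega>)}"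
        using measurable_space[OF levy_processD(4)[OF LT] elim(2)] by (auto simp: A_def space_pair_measure)
      have "emeasure ?PX ((\<lambda>x. (x, sample_path T \<omega>)) -` A) = emeasure M (sample_path X -` {x \<in> space path_space. Q x (sample_path T \<omega>)} \<inter> space M)"
        unfolding slice by (rule emeasure_distr) measurable
      also have "\<dots> = emeasure M {\<omega>'\<in>space M. \<forall>i\<in>{..<n}. X (s (Suc i)) \<omega>' - X (s i) \<omega>' \<in> B i}"
      proof (rule emeasure_eq_AE)
        show "AE \<omega>' in M. \<omega>' \<in> sample_path X -` {x \<in> space path_space. Q x (sample_path T \<omega>)} \<inter> space M \<longleftrightarrow>
          \<omega>' \<in> {\<omega>'\<in>space M. \<forall>i\<in>{..<n}. X (s (Suc i)) \<omega>' - X (s i) \<omega>' \<in> B i}"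
          using levy_processD(3)[OF X] AE_space
        proof eventually_elim
          case (elim \<omega>')
          have "path_at (sample_path X \<omega>') (sample_path T \<omega> (t i)) = X (s i) \<omega>'" if "i \<le> n" for i
            using path_at_path[of X, OF elim(1) s_nonneg[OF that]] t_nonneg[OF that] by (simp add: sample_path_def s_def)
          then show ?case using measurable_space[OF levy_processD(4)[OF X] elim(2)] elim(2)
            by (auto simp: Q_def)
        qed
        show "sample_path X -` {x \<in> space path_space. Q x (sample_path T \<omega>)} \<inter> space M \<in> events" by measurable
        show "{\<omega>'\<in>space M. \<forall>i\<in>{..<n}. X (s (Suc i)) \<omega>' - X (s i) \<omega>' \<in> B i} \<in> events"
          by (rule sets.sets_Collect_finite_All) auto
      qed
      also have "\<dots> = ennreal (\<Prod>i<n. prob {\<omega>'\<in>space M. X (s (Suc i) - s i) \<omega>' - X 0 \<omega>' \<in> B i})"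
        unfolding emeasure_eq_measure Ball_def lessThan_iff
        using levy_increments_prob[OF X, of s n B] s_nonneg[of 0] s_mono B by simp
      also have "\<dots> = (\<Prod>i<n. increment_law X (B i) (s (Suc i) - s i))"
        unfolding prod_ennreal[OF measure_nonneg, symmetric]
        by (intro prod.cong refl) (use s_mono in \<open>auto simp: increment_law_eq[OF X B] emeasure_eq_measure\<close>)
      finally show ?case by (simp add: s_def)
    qed
  qed
  show ?thesis unfolding 1 2 3 ..
qed

lemma emeasure_subordinate_increment:
  assumes X: "levy_process X" and T: "subordinator T"
    and ind: "indep_var path_space (sample_path X) path_space (sample_path T)"
    and t: "0 \<le> s" "s \<le> t" and B: "B \<in> sets borel"
  shows "emeasure M {\<omega>\<in>space M. subordinate X T t \<omega> - subordinate X T s \<omega> \<in> B} =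
    (\<integral>\<^sup>+\<omega>. increment_law X B (T t \<omega> - T s \<omega>) \<partial>M)"
  using emeasure_subordinate_increments[OF X T ind, of "\<lambda>i. if i = 0 then s else t" 1 "\<lambda>_. B"] t B
  by simp

text \<open>Stationarity of the increments of \<open>T\<close> makes the law of an increment depend on \<open>t - s\<close> only, which
yields both stationarity and stochastic continuity of the composition.\<close>
lemma emeasure_subordinate_increment':
  assumes X: "levy_process X" and T: "subordinator T"
    and ind: "indep_var path_space (sample_path X) path_space (sample_path T)"
    and t: "0 \<le> s" "s \<le> t" and B: "B \<in> sets borel"
  shows "emeasure M {\<omega>\<in>space M. subordinate X T t \<omega> - subordinate X T s \<omega> \<in> B} =
    (\<integral>\<^sup>+\<omega>. increment_law X B (T (t - s) \<omega> - T 0 \<omega>) \<partial>M)"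
proof -
  have LT: "levy_process T" using T by (simp add: subordinator_def)
  note [measurable] = increment_law_measurable[OF X B] levy_processD(1)[OF LT]
  have eq: "distr M borel (\<lambda>\<omega>. T t \<omega> - T s \<omega>) = distr M borel (\<lambda>\<omega>. T (t - s) \<omega> - T 0 \<omega>)"
  proof -
    have "distr M borel (\<lambda>\<omega>. T (s + (t - s)) \<omega> - T s \<omega>) = distr M borel (\<lambda>\<omega>. T (t - s) \<omega> - T 0 \<omega>)"
      using LT t unfolding levy_process_def stationary_increments_def by (metis diff_ge_0_iff_ge)
    then show ?thesis by simp
  qed
  have "(\<integral>\<^sup>+\<omega>. increment_law X B (T t \<omega> - T s \<omega>) \<partial>M) =
      (\<integral>\<^sup>+r. increment_law X B r \<partial>distr M borel (\<lambda>\<omega>. T t \<omega> - T s \<omega>))"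
    using t by (intro nn_integral_distr[symmetric]) measurable
  also have "\<dots> = (\<integral>\<^sup>+\<omega>. increment_law X B (T (t - s) \<omega> - T 0 \<omega>) \<partial>M)"
    unfolding eq using t by (intro nn_integral_distr) measurable
  finally show ?thesis using emeasure_subordinate_increment[OF assms] by simp
qed

text \<open>The counterpart of \<open>emeasure_subordinate_increments\<close> for characteristic functions: conditioning on
\<open>T\<close> replaces \<open>f (X s)\<close> by its mean.\<close>
lemma expectation_subordinate:
  fixes f h :: "real \<Rightarrow> complex"
  assumes X: "levy_process X" and T: "subordinator T"
    and ind: "indep_var path_space (sample_path X) path_space (sample_path T)"
    and f[measurable]: "f \<in> borel_measurable borel" "\<And>x. norm (f x) \<le> 1"
    and h[measurable]: "h \<in> borel_measurable borel" "\<And>s. 0 \<le> s \<Longrightarrow> expectation (\<lambda>\<omega>. f (X s \<omega>)) = h s"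
    and t: "0 \<le> t"
  shows "expectation (\<lambda>\<omega>. f (subordinate X T t \<omega>)) = expectation (\<lambda>\<omega>. h (T t \<omega>))"
proof -
  let ?PX = "distr M path_space (sample_path X)" and ?PT = "distr M path_space (sample_path T)"
  have LT: "levy_process T" using T by (simp add: subordinator_def)
  note [measurable] = levy_processD(4)[OF X] levy_processD(4)[OF LT] levy_processD(1)[OF LT t]
  note XM = levy_processD(1)[OF X]
  interpret PX: prob_space ?PX by (rule prob_space_distr) measurable
  interpret PT: prob_space ?PT by (rule prob_space_distr) measurable
  interpret PP: pair_prob_space ?PX ?PT ..
  have coord[measurable]: "(\<lambda>p. snd p t) \<in> borel_measurable (path_space \<Otimes>\<^sub>M path_space)"
    "(\<lambda>\<tau>. \<tau> t) \<in> borel_measurable path_space"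
    using t by (auto intro!: measurable_compose[OF measurable_snd measurable_component_singleton])
  let ?g = "\<lambda>x \<tau>. f (path_at x (\<tau> t))"
  have g[measurable]: "case_prod ?g \<in> borel_measurable (path_space \<Otimes>\<^sub>M path_space)"
    unfolding split_beta by measurable
  have int: "integrable (?PX \<Otimes>\<^sub>M ?PT) (case_prod ?g)"
    by (rule PP.integrable_const_bound[of _ 1]) (auto simp: f)
  have "expectation (\<lambda>\<omega>. f (subordinate X T t \<omega>)) = expectation (\<lambda>\<omega>. case_prod ?g (sample_path X \<omega>, sample_path T \<omega>))"
    using t by (simp add: subordinate_def sample_path_def)
  also have "\<dots> = integral\<^sup>L (distr M (path_space \<Otimes>\<^sub>M path_space) (\<lambda>\<omega>. (sample_path X \<omega>, sample_path T \<omega>))) (case_prod ?g)"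
    by (rule integral_distr[symmetric]) measurable
  also have "distr M (path_space \<Otimes>\<^sub>M path_space) (\<lambda>\<omega>. (sample_path X \<omega>, sample_path T \<omega>)) = ?PX \<Otimes>\<^sub>M ?PT"
    using ind by (simp add: indep_var_distribution_eq)
  also have "integral\<^sup>L (?PX \<Otimes>\<^sub>M ?PT) (case_prod ?g) = (\<integral>\<tau>. (\<integral>x. ?g x \<tau> \<partial>?PX) \<partial>?PT)"
    by (rule PP.integral_snd[OF int, symmetric])
  also have "\<dots> = (\<integral>\<omega>. (\<integral>x. ?g x (sample_path T \<omega>) \<partial>?PX) \<partial>M)"
    by (rule integral_distr) (auto intro!: PX.borel_measurable_lebesgue_integral)
  also have "\<dots> = expectation (\<lambda>\<omega>. h (T t \<omega>))"
  proof (rule integral_cong_AE)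
    show "AE \<omega> in M. (\<integral>x. ?g x (sample_path T \<omega>) \<partial>?PX) = h (T t \<omega>)"
      using subordinator_paths[OF T]
    proof eventually_elim
      case (elim \<omega>)
      then have s: "0 \<le> T t \<omega>" using t by auto
      note [measurable] = XM[OF s]
      have "(\<integral>x. ?g x (sample_path T \<omega>) \<partial>?PX) = (\<integral>\<omega>'. ?g (sample_path X \<omega>') (sample_path T \<omega>) \<partial>M)"
        by (rule integral_distr) measurable
      also have "\<dots> = (\<integral>\<omega>'. f (X (T t \<omega>) \<omega>') \<partial>M)"
      proof (rule integral_cong_AE)
        show "AE \<omega>' in M. f (path_at (sample_path X \<omega>') (sample_path T \<omega> t)) = f (X (T t \<omega>) \<omega>')"
          using levy_processD(3)[OF X] by eventually_elim (use t in \<open>simp add: sample_path_def[of T] path_at_path s\<close>)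
      qed measurable
      finally show ?case using h(2)[OF s] by simp
    qed
    show "(\<lambda>\<omega>. \<integral>x. ?g x (sample_path T \<omega>) \<partial>?PX) \<in> borel_measurable M"
      by measurable
  qed measurable
  finally show ?thesis .
qed

lemma stochastically_continuous_at_0:
  assumes "levy_process X" "0 < e"
  shows "((\<lambda>r. prob {\<omega>\<in>space M. \<bar>X r \<omega> - X 0 \<omega>\<bar> > e}) \<longlongrightarrow> 0) (at_right 0)"
proof -
  have "((\<lambda>r. prob {\<omega>\<in>space M. \<bar>X r \<omega> - X 0 \<omega>\<bar> > e}) \<longlongrightarrow> 0) (at 0 within {0..})"
    using assms unfolding levy_process_def stochastically_continuous_def by auto
  then show ?thesis by (rule tendsto_within_subset) auto
qed

text \<open>For a small time difference \<open>r\<close>, the increment \<open>T(r) - T(0)\<close> exceeds a given \<open>d\<close> only with small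
probability, and on an increment shorter than \<open>d\<close> the process \<open>X\<close> moves by more than \<open>e\<close> only with
small probability.\<close>
lemma subordinate_stochastically_continuous:
  assumes X: "levy_process X" and T: "subordinator T"
    and ind: "indep_var path_space (sample_path X) path_space (sample_path T)"
  shows "stochastically_continuous (subordinate X T)"
  unfolding stochastically_continuous_def
proof safe
  fix s e :: real assume s: "0 \<le> s" and e: "0 < e"
  have LT: "levy_process T" using T by (simp add: subordinator_def)
  let ?Y = "subordinate X T" and ?B = "{x::real. e < \<bar>x\<bar>}"
  have B[measurable]: "?B \<in> sets borel" by measurable
  note YM = subordinate_measurable[OF X T]
  define H where "H r = (\<integral>\<^sup>+\<omega>. increment_law X ?B (T r \<omega> - T 0 \<omega>) \<partial>M)" for r
  have prob_eq: "ennreal (prob {\<omega>\<in>space M. \<bar>?Y t \<omega> - ?Y s \<omega>\<bar> > e}) = H \<bar>t - s\<bar>" if t: "0 \<le> t" for t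
  proof (cases "s \<le> t")
    case True
    then show ?thesis using emeasure_subordinate_increment'[OF X T ind s True B]
      by (simp add: H_def emeasure_eq_measure)
  next
    case False
    then show ?thesis using emeasure_subordinate_increment'[OF X T ind t _ B, of s]
      by (simp add: H_def emeasure_eq_measure abs_minus_commute)
  qed
  have small: "\<forall>\<^sub>F r in at_right 0. H r < ennreal \<eta>" if \<eta>: "0 < \<eta>" for \<eta>
  proof -
    have "\<forall>\<^sub>F r in at_right 0. prob {\<omega>\<in>space M. \<bar>X r \<omega> - X 0 \<omega>\<bar> > e} < \<eta> / 3"
      using order_tendstoD(2)[OF stochastically_continuous_at_0[OF X e], of "\<eta> / 3"] \<eta> by simp
    then obtain d where d: "0 < d" "\<And>r. 0 < r \<Longrightarrow> r < d \<Longrightarrow> prob {\<omega>\<in>space M. \<bar>X r \<omega> - X 0 \<omega>\<bar> > e} < \<eta> / 3"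
      by (auto simp: eventually_at_right_field)
    have "\<forall>\<^sub>F r in at_right 0. prob {\<omega>\<in>space M. \<bar>T r \<omega> - T 0 \<omega>\<bar> > d / 2} < \<eta> / 3"
      using order_tendstoD(2)[OF stochastically_continuous_at_0[OF LT, of "d/2"], of "\<eta> / 3"] \<eta> d by simp
    moreover have "\<forall>\<^sub>F r in at_right (0::real). 0 < r" by (simp add: eventually_at_filter)
    ultimately show ?thesis
    proof eventually_elim
      case (elim r)
      have [measurable]: "T r \<in> borel_measurable M" "T 0 \<in> borel_measurable M"
        using elim by (auto intro: levy_processD[OF LT])
      let ?A = "{\<omega>\<in>space M. \<bar>T r \<omega> - T 0 \<omega>\<bar> > d / 2}"
      have "H r \<le> (\<integral>\<^sup>+\<omega>. ennreal (\<eta> / 3) + indicator ?A \<omega> \<partial>M)"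
        unfolding H_def
      proof (rule nn_integral_mono_AE)
        show "AE \<omega> in M. increment_law X ?B (T r \<omega> - T 0 \<omega>) \<le> ennreal (\<eta> / 3) + indicator ?A \<omega>"
          using subordinator_paths[OF T] AE_space
        proof eventually_elim
          case (elim \<omega>)
          have nn: "0 \<le> T r \<omega> - T 0 \<omega>" using elim \<open>0 < r\<close> by auto
          show ?case
          proof (cases "\<omega> \<in> ?A")
            case True
            then show ?thesis unfolding increment_law_eq[OF X B nn]
              by (intro order_trans[OF emeasure_le_1]) simp
          next
            case False
            then have less: "T r \<omega> - T 0 \<omega> < d" using nn d(1) elim(2) by auto
            have "prob {\<omega>'\<in>space M. e < \<bar>X (T r \<omega> - T 0 \<omega>) \<omega>' - X 0 \<omega>'\<bar>} \<le> \<eta> / 3"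
            proof (cases "T r \<omega> - T 0 \<omega> = 0")
              case True
              then show ?thesis using e \<eta> by simp
            next
              case False
              then show ?thesis using d(2)[of "T r \<omega> - T 0 \<omega>"] nn less by simp
            qed
            then show ?thesis unfolding increment_law_eq[OF X B nn] using False
              by (simp add: emeasure_eq_measure ennreal_leI)
          qed
        qed
      qed
      also have "\<dots> = ennreal (\<eta> / 3) + emeasure M ?A"
        by (subst nn_integral_add) (auto simp: emeasure_space_1)
      also have "\<dots> = ennreal (\<eta> / 3 + prob ?A)"
        using \<eta> by (simp add: emeasure_eq_measure ennreal_plus)
      also have "\<dots> < ennreal \<eta>" using elim \<eta> by (intro ennreal_lessI) auto
      finally show ?case .
    qed
  qed
  show "((\<lambda>t. prob {\<omega>\<in>space M. \<bar>?Y t \<omega> - ?Y s \<omega>\<bar> > e}) \<longlongrightarrow> 0) (at s within {0..})"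
  proof (rule tendstoI)
    fix \<eta> :: real assume \<eta>: "0 < \<eta>"
    obtain d where d: "0 < d" "\<And>r. 0 < r \<Longrightarrow> r < d \<Longrightarrow> H r < ennreal \<eta>"
      using small[OF \<eta>] by (auto simp: eventually_at_right_field)
    show "\<forall>\<^sub>F t in at s within {0..}. dist (prob {\<omega>\<in>space M. \<bar>?Y t \<omega> - ?Y s \<omega>\<bar> > e}) 0 < \<eta>"
      unfolding eventually_at
    proof (intro exI[of _ d] conjI ballI impI d(1))
      fix t assume t: "t \<in> {0..}" "t \<noteq> s \<and> dist t s < d"
      then have "ennreal (prob {\<omega>\<in>space M. \<bar>?Y t \<omega> - ?Y s \<omega>\<bar> > e}) < ennreal \<eta>"
        using prob_eq[of t] d(2)[of "\<bar>t - s\<bar>"] by (auto simp: dist_real_def)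
      then show "dist (prob {\<omega>\<in>space M. \<bar>?Y t \<omega> - ?Y s \<omega>\<bar> > e}) 0 < \<eta>"
        using \<eta> by (simp add: ennreal_less_iff)
    qed
  qed
qed

text \<open>The integrand in \<open>emeasure_subordinate_increments\<close> is a product of functions of the separate
increments of \<open>T\<close>, which are independent; the integral therefore factorises, and each factor is the
law of one increment of the composition.\<close>
lemma subordinate_independent_increments:
  assumes X: "levy_process X" and T: "subordinator T"
    and ind: "indep_var path_space (sample_path X) path_space (sample_path T)"
  shows "independent_increments (subordinate X T)"
  unfolding independent_increments_def
proof safe
  fix n and t :: "nat \<Rightarrow> real" assume t: "0 \<le> t 0" "\<forall>i<n. t i < t (Suc i)"
  let ?D = "\<lambda>i \<omega>. subordinate X T (t (Suc i)) \<omega> - subordinate X T (t i) \<omega>"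
  have LT: "levy_process T" using T by (simp add: subordinator_def)
  have t_nonneg: "0 \<le> t i" if "i \<le> n" for i
    using that
  proof (induction i)
    case (Suc i) then show ?case using t(2)[rule_format, of i] by simp
  qed (use t in simp)
  show "indep_vars (\<lambda>_. borel) ?D {..<n}"
  proof (cases "n = 0")
    case True
    then show ?thesis by (simp add: indep_vars_def2 indep_sets_def)
  next
    case False
    have D[measurable]: "?D i \<in> borel_measurable M" if "i < n" for i
      using that t_nonneg by (intro borel_measurable_diff subordinate_measurable[OF X T]) auto
    have "(\<forall>A\<in>(\<Pi> i\<in>{..<n}. sets borel). prob (\<Inter>j\<in>{..<n}. ?D j -` A j \<inter> space M) =
        (\<Prod>j\<in>{..<n}. prob (?D j -` A j \<inter> space M)))"
    proof
      fix A :: "nat \<Rightarrow> real set" assume A: "A \<in> (\<Pi> i\<in>{..<n}. sets borel)"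
      define B where "B i = (if i < n then A i else UNIV)" for i
      have B[measurable]: "B i \<in> sets borel" for i using A by (auto simp: B_def)
      note [measurable] = increment_law_measurable[OF X B]
      have indT: "indep_vars (\<lambda>_. borel) (\<lambda>i \<omega>. T (t (Suc i)) \<omega> - T (t i) \<omega>) {..<n}"
        using LT t unfolding levy_process_def independent_increments_def by blast
      have "(\<Inter>j\<in>{..<n}. ?D j -` A j \<inter> space M) = {\<omega>\<in>space M. \<forall>i<n. ?D i \<omega> \<in> B i}"
        using False by (auto simp: B_def)
      also have "emeasure M \<dots> = (\<integral>\<^sup>+\<omega>. (\<Prod>i<n. increment_law X (B i) (T (t (Suc i)) \<omega> - T (t i) \<omega>)) \<partial>M)"
        using t by (intro emeasure_subordinate_increments[OF X T ind]) auto
      also have "\<dots> = (\<Prod>i<n. \<integral>\<^sup>+\<omega>. increment_law X (B i) (T (t (Suc i)) \<omega> - T (t i) \<omega>) \<partial>M)"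
        by (rule indep_vars_nn_integral[OF _ indep_vars_compose2[OF indT]]) auto
      also have "\<dots> = (\<Prod>i<n. emeasure M (?D i -` A i \<inter> space M))"
      proof (intro prod.cong refl)
        fix i assume i: "i \<in> {..<n}"
        have "?D i -` A i \<inter> space M = {\<omega>\<in>space M. ?D i \<omega> \<in> B i}" using i by (auto simp: B_def)
        then show "(\<integral>\<^sup>+\<omega>. increment_law X (B i) (T (t (Suc i)) \<omega> - T (t i) \<omega>) \<partial>M) =
            emeasure M (?D i -` A i \<inter> space M)"
          using emeasure_subordinate_increment[OF X T ind, of "t i" "t (Suc i)" "B i"] t i t_nonneg[of i] B
          by (auto simp: less_imp_le)
      qed
      finally show "prob (\<Inter>j\<in>{..<n}. ?D j -` A j \<inter> space M) = (\<Prod>j\<in>{..<n}. prob (?D j -` A j \<inter> space M))"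
        by (simp add: emeasure_eq_measure prod_ennreal prod_nonneg)
    qed
    then show ?thesis
      using False D by (subst indep_vars_finite[where E = "\<lambda>_. sets borel"])
        (auto simp: Int_stable_def sets.sigma_sets_eq[of borel, simplified])
  qed
qed

lemma levy_process_subordinate:
  assumes X: "levy_process X" and T: "subordinator T"
    and ind: "indep_var path_space (sample_path X) path_space (sample_path T)"
  shows "levy_process (subordinate X T)"
  unfolding levy_process_def
proof (intro conjI allI impI)
  let ?Y = "subordinate X T"
  show "?Y t \<in> borel_measurable M" if "0 \<le> t" for t
    by (rule subordinate_measurable[OF X T that])
  show "AE \<omega> in M. ?Y 0 \<omega> = 0"
    using subordinate_AE_eq[OF X T] subordinator_paths[OF T] levy_processD(2)[OF X]
    by eventually_elim simp
  show "independent_increments ?Y" by (rule subordinate_independent_increments[OF assms])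
  show "stochastically_continuous ?Y" by (rule subordinate_stochastically_continuous[OF assms])
  show "AE \<omega> in M. cadlag (\<lambda>t. ?Y t \<omega>)"
    using subordinate_AE_eq[OF X T] subordinator_paths[OF T] levy_processD(3)[OF X]
  proof eventually_elim
    case (elim \<omega>)
    have "cadlag (\<lambda>t. X (T t \<omega>) \<omega>)"
      by (rule cadlag_compose[of "\<lambda>t. X t \<omega>" "\<lambda>t. T t \<omega>"]) (use elim in blast)+
    then show ?case by (rule cadlag_cong) (use elim(1) in simp)
  qed
  show "stationary_increments ?Y"
    unfolding stationary_increments_def
  proof (intro allI impI)
    fix s t :: real assume st: "0 \<le> s" "0 \<le> t"
    note [measurable] = subordinate_measurable[OF X T]
    show "distr M borel (\<lambda>\<omega>. ?Y (s + t) \<omega> - ?Y s \<omega>) = distr M borel (\<lambda>\<omega>. ?Y t \<omega> - ?Y 0 \<omega>)"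
    proof (rule measure_eqI)
      fix B assume "B \<in> sets (distr M borel (\<lambda>\<omega>. ?Y (s + t) \<omega> - ?Y s \<omega>))"
      then have B: "B \<in> sets borel" by simp
      have *: "emeasure M {\<omega>\<in>space M. ?Y (s + t) \<omega> - ?Y s \<omega> \<in> B} = emeasure M {\<omega>\<in>space M. ?Y t \<omega> - ?Y 0 \<omega> \<in> B}"
        using emeasure_subordinate_increment'[OF X T ind _ _ B, of s "s + t"]
          emeasure_subordinate_increment'[OF X T ind _ _ B, of 0 t] st by simp
      show "emeasure (distr M borel (\<lambda>\<omega>. ?Y (s + t) \<omega> - ?Y s \<omega>)) B =
          emeasure (distr M borel (\<lambda>\<omega>. ?Y t \<omega> - ?Y 0 \<omega>)) B"
        using st B * by (simp add: emeasure_distr vimage_def Int_def conj_commute)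
    qed simp
  qed
qed

end

section \<open>Passing to the completion\<close>

lemma borel_measurable_completion_AE:
  assumes f: "f \<in> M \<rightarrow>\<^sub>M N" and eq: "AE x in M. f x = g x" and g: "g \<in> space M \<rightarrow> space N"
  shows "g \<in> completion M \<rightarrow>\<^sub>M N"
proof (rule measurableI)
  show "g x \<in> space N" if "x \<in> space (completion M)" for x using g that by auto
  fix A assume A: "A \<in> sets N"
  show "g -` A \<inter> space (completion M) \<in> sets (completion M)"
  proof (rule completion.in_sets_AE[where A = "f -` A \<inter> space M"])
    show "AE x in completion M. x \<in> f -` A \<inter> space M \<longleftrightarrow> x \<in> g -` A \<inter> space (completion M)"
      unfolding AE_completion_iff using eq by eventually_elim simp
    show "f -` A \<inter> space M \<in> sets (completion M)" using measurable_sets[OF f A] by blast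
  qed simp
qed

lemma distr_completion_AE:
  assumes f: "f \<in> M \<rightarrow>\<^sub>M N" and g: "g \<in> completion M \<rightarrow>\<^sub>M N" and eq: "AE x in M. f x = g x"
  shows "distr (completion M) N g = distr M N f"
proof (rule measure_eqI)
  fix A assume "A \<in> sets (distr (completion M) N g)"
  then have A: "A \<in> sets N" by simp
  have fA: "f -` A \<inter> space M \<in> sets M" by (rule measurable_sets[OF f A])
  have "emeasure (completion M) (g -` A \<inter> space (completion M)) = emeasure (completion M) (f -` A \<inter> space M)"
  proof (rule emeasure_eq_AE)
    show "AE x in completion M. x \<in> g -` A \<inter> space (completion M) \<longleftrightarrow> x \<in> f -` A \<inter> space M"
      unfolding AE_completion_iff using eq by eventually_elim simp
  qed (use fA measurable_sets[OF g A] in auto)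
  also have "\<dots> = emeasure M (f -` A \<inter> space M)" using fA by simp
  finally show "emeasure (distr (completion M) N g) A = emeasure (distr M N f) A"
    using A f g by (simp add: emeasure_distr)
qed simp

context prob_space
begin

text \<open>Measurability of \<open>Z\<close> is what the completion provides. The remaining clauses depend on
finite-dimensional laws or on almost sure path properties, and both are insensitive to a common
exceptional null set.\<close>
lemma levy_process_completion:
  assumes Y: "levy_process Y" and eq: "AE \<omega> in M. \<forall>t\<ge>0. Z t \<omega> = Y t \<omega>"
  shows "prob_space.levy_process (completion M) Z"
proof -
  interpret C: prob_space "completion M" by (rule prob_space_completion)
  have YM: "Y t \<in> borel_measurable M" if "0 \<le> t" for t by (rule levy_processD(1)[OF Y that])
  have eq_t: "AE \<omega> in M. Y t \<omega> = Z t \<omega>" if "0 \<le> t" for t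
    using eq by eventually_elim (use that in simp)
  have ZM: "Z t \<in> borel_measurable (completion M)" if "0 \<le> t" for t
    by (rule borel_measurable_completion_AE[OF YM[OF that] eq_t[OF that]]) simp
  have inc: "distr (completion M) borel (\<lambda>\<omega>. Z t \<omega> - Z s \<omega>) = distr M borel (\<lambda>\<omega>. Y t \<omega> - Y s \<omega>)"
    if "0 \<le> s" "0 \<le> t" for s t
  proof (rule distr_completion_AE)
    show "AE \<omega> in M. Y t \<omega> - Y s \<omega> = Z t \<omega> - Z s \<omega>"
      using eq by eventually_elim (use that in simp)
  qed (use YM ZM that in auto)
  show ?thesis
    unfolding C.levy_process_def
  proof (intro conjI allI impI)
    show "Z t \<in> borel_measurable (completion M)" if "0 \<le> t" for t using ZM[OF that] .
    show "AE \<omega> in completion M. Z 0 \<omega> = 0"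
      unfolding AE_completion_iff using levy_processD(2)[OF Y] eq by eventually_elim simp
    show "AE \<omega> in completion M. cadlag (\<lambda>t. Z t \<omega>)"
      unfolding AE_completion_iff using levy_processD(3)[OF Y] eq
    proof eventually_elim
      case (elim \<omega>)
      then show ?case by (intro cadlag_cong[OF elim(1)]) simp
    qed
    show "C.stationary_increments Z"
      using Y unfolding levy_process_def stationary_increments_def C.stationary_increments_def
      by (simp add: inc)
    show "C.independent_increments Z"
      unfolding C.independent_increments_def
    proof safe
      fix n and t :: "nat \<Rightarrow> real" assume t: "0 \<le> t 0" "\<forall>i<n. t i < t (Suc i)"
      have nn: "0 \<le> t i" if "i \<le> n" for i
        using that
      proof (induction i)
        case (Suc i) then show ?case using t(2)[rule_format, of i] by simp
      qed (use t in simp)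
      show "C.indep_vars (\<lambda>_. borel) (\<lambda>i \<omega>. Z (t (Suc i)) \<omega> - Z (t i) \<omega>) {..<n}"
      proof (cases "n = 0")
        case True
        then show ?thesis by (simp add: C.indep_vars_def2 C.indep_sets_def)
      next
        case False
        have mZ: "(\<lambda>\<omega>. Z (t (Suc i)) \<omega> - Z (t i) \<omega>) \<in> borel_measurable (completion M)" if "i \<in> {..<n}" for i
          using nn that by (intro borel_measurable_diff ZM) auto
        have mY: "(\<lambda>\<omega>. Y (t (Suc i)) \<omega> - Y (t i) \<omega>) \<in> borel_measurable M" if "i \<in> {..<n}" for i
          using nn that by (intro borel_measurable_diff YM) auto
        have "indep_vars (\<lambda>_. borel) (\<lambda>i \<omega>. Y (t (Suc i)) \<omega> - Y (t i) \<omega>) {..<n}"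
          using Y t unfolding levy_process_def independent_increments_def by blast
        then have *: "distr M (PiM {..<n} (\<lambda>_. borel)) (\<lambda>\<omega>. \<lambda>i\<in>{..<n}. Y (t (Suc i)) \<omega> - Y (t i) \<omega>) =
            PiM {..<n} (\<lambda>i. distr M borel (\<lambda>\<omega>. Y (t (Suc i)) \<omega> - Y (t i) \<omega>))"
          using False mY by (subst (asm) indep_vars_iff_distr_eq_PiM') auto
        have "distr (completion M) (PiM {..<n} (\<lambda>_. borel)) (\<lambda>\<omega>. \<lambda>i\<in>{..<n}. Z (t (Suc i)) \<omega> - Z (t i) \<omega>) =
            distr M (PiM {..<n} (\<lambda>_. borel)) (\<lambda>\<omega>. \<lambda>i\<in>{..<n}. Y (t (Suc i)) \<omega> - Y (t i) \<omega>)"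
        proof (rule distr_completion_AE)
          show "AE \<omega> in M. (\<lambda>i\<in>{..<n}. Y (t (Suc i)) \<omega> - Y (t i) \<omega>) = (\<lambda>i\<in>{..<n}. Z (t (Suc i)) \<omega> - Z (t i) \<omega>)"
            using eq by eventually_elim (use nn in \<open>auto intro!: restrict_ext\<close>)
        qed (intro measurable_restrict mY mZ; assumption)+
        also note *
        also have "PiM {..<n} (\<lambda>i. distr M borel (\<lambda>\<omega>. Y (t (Suc i)) \<omega> - Y (t i) \<omega>)) =
            PiM {..<n} (\<lambda>i. distr (completion M) borel (\<lambda>\<omega>. Z (t (Suc i)) \<omega> - Z (t i) \<omega>))"
          by (intro PiM_cong refl inc[symmetric] nn) auto
        finally show ?thesis
          using False mZ by (subst C.indep_vars_iff_distr_eq_PiM') auto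
      qed
    qed
    show "C.stochastically_continuous Z"
      unfolding C.stochastically_continuous_def
    proof safe
      fix s e :: real assume s: "0 \<le> s" and e: "0 < e"
      have "((\<lambda>t. prob {\<omega>\<in>space M. \<bar>Y t \<omega> - Y s \<omega>\<bar> > e}) \<longlongrightarrow> 0) (at s within {0..})"
        using Y s e unfolding levy_process_def stochastically_continuous_def by blast
      moreover have "prob {\<omega>\<in>space M. \<bar>Y t \<omega> - Y s \<omega>\<bar> > e} =
          C.prob {\<omega>\<in>space (completion M). \<bar>Z t \<omega> - Z s \<omega>\<bar> > e}" if t: "0 \<le> t" for t
      proof -
        let ?B = "{x::real. e < \<bar>x\<bar>}"
        have B: "?B \<in> sets borel" by measurable
        have "measure (distr (completion M) borel (\<lambda>\<omega>. Z t \<omega> - Z s \<omega>)) ?B =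
            measure (distr M borel (\<lambda>\<omega>. Y t \<omega> - Y s \<omega>)) ?B" by (simp add: inc s t)
        then show ?thesis
          using B by (simp add: measure_distr borel_measurable_diff YM ZM s t vimage_def Int_def conj_commute)
      qed
      then have "\<forall>\<^sub>F t in at s within {0..}. prob {\<omega>\<in>space M. \<bar>Y t \<omega> - Y s \<omega>\<bar> > e} =
          C.prob {\<omega>\<in>space (completion M). \<bar>Z t \<omega> - Z s \<omega>\<bar> > e}"
        by (simp add: eventually_at_filter)
      ultimately show "((\<lambda>t. C.prob {\<omega>\<in>space (completion M). \<bar>Z t \<omega> - Z s \<omega>\<bar> > e}) \<longlongrightarrow> 0) (at s within {0..})"
        by (rule Lim_transform_eventually)
    qed
  qed
qed

text \<open>Together with continuity and \<open>g 0 = 0\<close>, the exponential formula determines the distinguished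
logarithm as \<open>- t g\<close>, and the factor \<open>t\<close> cancels.\<close>
lemma levy_symbol_completion:
  assumes Y: "Y t \<in> borel_measurable M" and eq: "AE \<omega> in M. Z t \<omega> = Y t \<omega>"
    and char: "\<And>u. expectation (\<lambda>\<omega>. exp (\<i> * of_real u * of_real (Y t \<omega>))) = exp (- (of_real t * g u))"
    and g: "continuous_on UNIV g" "g 0 = 0" and t: "0 < t"
  shows "levy_symbol (completion M) Z t u = - g u"
proof -
  have ZM: "Z t \<in> borel_measurable (completion M)"
    by (rule borel_measurable_completion_AE[OF Y]) (use eq in \<open>auto elim: eventually_mono\<close>)
  have YM: "Y t \<in> borel_measurable (completion M)" using Y by (rule measurable_completion)
  have "(LINT \<omega>|completion M. exp (\<i> * of_real v * of_real (Z t \<omega>))) = exp (- (of_real t * g v))" for v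
  proof -
    have "(LINT \<omega>|completion M. exp (\<i> * complex_of_real v * of_real (Z t \<omega>))) =
        (LINT \<omega>|completion M. exp (\<i> * of_real v * of_real (Y t \<omega>)))"
    proof (rule integral_cong_AE)
      show "AE \<omega> in completion M. exp (\<i> * complex_of_real v * of_real (Z t \<omega>)) = exp (\<i> * of_real v * of_real (Y t \<omega>))"
        unfolding AE_completion_iff using eq by eventually_elim simp
    qed (use ZM YM in measurable)
    also have "\<dots> = expectation (\<lambda>\<omega>. exp (\<i> * of_real v * of_real (Y t \<omega>)))"
      by (rule integral_completion) (use Y in measurable)
    finally show ?thesis using char by simp
  qed
  then have "distinguished_log (\<lambda>v. LINT \<omega>|completion M. exp (\<i> * of_real v * of_real (Z t \<omega>))) =
      (\<lambda>v. - (of_real t * g v))"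
    using g by (intro distinguished_log_eqI) (auto intro!: continuous_intros)
  then show ?thesis using t by (simp add: levy_symbol_def)
qed

end

section \<open>Laplace transforms on the closed right half-plane\<close>

lemma exp_partial_sum_le:
  fixes r :: real
  assumes "0 \<le> r" "finite I"
  shows "(\<Sum>k\<in>I. r ^ k / fact k) \<le> exp r"
proof -
  have "(\<lambda>k. r ^ k / fact k) sums exp r" using exp_converges[of r] by (simp add: divide_inverse mult.commute)
  then have "summable (\<lambda>k. r ^ k / fact k)" "exp r = (\<Sum>k. r ^ k / fact k)" by (auto simp: sums_iff)
  moreover have "(\<Sum>k\<in>I. r ^ k / fact k) \<le> (\<Sum>k. r ^ k / fact k)"
    using calculation(1) assms by (intro sum_le_suminf) auto
  ultimately show ?thesis by simp
qed

context prob_space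
begin

text \<open>Around a real centre \<open>c\<close> the exponential series may be integrated term by term on the whole disc of
radius \<open>c\<close>: its partial sums are bounded by \<open>exp (- (c - \<bar>w - c\<bar>) Z) \<le> 1\<close>. These discs, which touch
the imaginary axis, exhaust the half-plane.\<close>
lemma holomorphic_laplace_transform:
  assumes [measurable]: "Z \<in> borel_measurable M" and nonneg: "AE \<omega> in M. 0 \<le> Z \<omega>"
  shows "(\<lambda>z. expectation (\<lambda>\<omega>. exp (- z * complex_of_real (Z \<omega>)))) holomorphic_on {z. 0 < Re z}"
proof -
  define F where "F z = expectation (\<lambda>\<omega>. exp (- z * complex_of_real (Z \<omega>)))" for z
  define a where "a c k = expectation (\<lambda>\<omega>. complex_of_real (exp (- c * Z \<omega>) * (- Z \<omega>) ^ k / fact k))" for c k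
  have F_ball: "F holomorphic_on ball (of_real c) c" if c: "0 < c" for c :: real
  proof (rule power_series_holomorphic[where a = "a c"])
    fix w assume "w \<in> ball (complex_of_real c) c"
    then have w: "norm (w - of_real c) < c" by (simp add: dist_norm norm_minus_commute)
    let ?t = "\<lambda>k \<omega>. complex_of_real (exp (- c * Z \<omega>) * (- Z \<omega>) ^ k / fact k) * (w - of_real c) ^ k"
    have int: "integrable M (\<lambda>\<omega>. complex_of_real (exp (- c * Z \<omega>) * (- Z \<omega>) ^ k / fact k))" for k
    proof (rule integrable_const_bound[of _ "inverse (c ^ k)"])
      show "AE \<omega> in M. norm (complex_of_real (exp (- c * Z \<omega>) * (- Z \<omega>) ^ k / fact k)) \<le> inverse (c ^ k)"
        using nonneg
      proof eventually_elim
        case (elim \<omega>)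
        have "(c * Z \<omega>) ^ k / fact k \<le> exp (c * Z \<omega>)"
          using exp_partial_sum_le[of "c * Z \<omega>" "{k}"] elim c by simp
        then have "exp (- (c * Z \<omega>)) * ((c * Z \<omega>) ^ k / fact k) \<le> exp (- (c * Z \<omega>)) * exp (c * Z \<omega>)"
          by (intro mult_left_mono) auto
        then have "exp (- (c * Z \<omega>)) * (c ^ k * (Z \<omega> ^ k / fact k)) \<le> 1"
          by (simp add: exp_minus power_mult_distrib)
        then have "exp (- (c * Z \<omega>)) * (Z \<omega> ^ k / fact k) \<le> inverse (c ^ k)"
          using c by (simp add: field_simps)
        then show ?case using elim by (simp add: norm_mult norm_divide norm_power abs_mult power_abs)
      qed
    qed measurable
    have "(\<lambda>n. expectation (\<lambda>\<omega>. \<Sum>k<n. ?t k \<omega>)) \<longlonglongrightarrow> expectation (\<lambda>\<omega>. exp (- w * complex_of_real (Z \<omega>)))"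
    proof (rule integral_dominated_convergence[where w = "\<lambda>_. 1"])
      show "AE \<omega> in M. (\<lambda>n. \<Sum>k<n. ?t k \<omega>) \<longlonglongrightarrow> exp (- w * complex_of_real (Z \<omega>))"
      proof (rule AE_I2)
        fix \<omega>
        let ?y = "- of_real (Z \<omega>) * (w - of_real c)"
        have "(\<lambda>k. ?y ^ k /\<^sub>R fact k) sums exp ?y" by (rule exp_converges)
        then have "(\<lambda>k. exp (- of_real (c * Z \<omega>)) * (?y ^ k /\<^sub>R fact k)) sums (exp (- of_real (c * Z \<omega>)) * exp ?y)"
          by (rule sums_mult)
        moreover have "exp (- of_real (c * Z \<omega>)) * exp ?y = exp (- w * complex_of_real (Z \<omega>))"
          by (simp add: exp_add[symmetric] algebra_simps)
        moreover have "exp (- of_real (c * Z \<omega>)) * (?y ^ k /\<^sub>R fact k) = ?t k \<omega>" for k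
          unfolding power_mult_distrib
          by (simp add: scaleR_conv_of_real exp_of_real[symmetric] field_simps)
        ultimately show "(\<lambda>n. \<Sum>k<n. ?t k \<omega>) \<longlonglongrightarrow> exp (- w * complex_of_real (Z \<omega>))"
          by (simp add: sums_def)
      qed
      show "AE \<omega> in M. norm (\<Sum>k<n. ?t k \<omega>) \<le> 1" for n
        using nonneg
      proof eventually_elim
        case (elim \<omega>)
        have "norm (\<Sum>k<n. ?t k \<omega>) \<le> (\<Sum>k<n. exp (- c * Z \<omega>) * ((Z \<omega> * norm (w - of_real c)) ^ k / fact k))"
          using elim by (intro sum_norm_le) (simp add: norm_mult norm_divide norm_power abs_mult power_abs power_mult_distrib)
        also have "\<dots> = exp (- c * Z \<omega>) * (\<Sum>k<n. (Z \<omega> * norm (w - of_real c)) ^ k / fact k)"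
          by (simp add: sum_distrib_left)
        also have "\<dots> \<le> exp (- c * Z \<omega>) * exp (Z \<omega> * norm (w - of_real c))"
          using elim by (intro mult_left_mono exp_partial_sum_le) auto
        also have "\<dots> = exp (- (Z \<omega> * (c - norm (w - of_real c))))"
          by (simp add: exp_add[symmetric] algebra_simps)
        also have "\<dots> \<le> 1" using elim w by simp
        finally show ?case .
      qed
    qed auto
    moreover have "expectation (\<lambda>\<omega>. \<Sum>k<n. ?t k \<omega>) = (\<Sum>k<n. a c k * (w - of_real c) ^ k)" for n
    proof -
      have "expectation (\<lambda>\<omega>. \<Sum>k<n. ?t k \<omega>) = (\<Sum>k<n. expectation (?t k))"
        by (rule Bochner_Integration.integral_sum) (rule integrable_mult_left, rule int)
      also have "\<dots> = (\<Sum>k<n. a c k * (w - of_real c) ^ k)"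
        unfolding a_def by (intro sum.cong refl integral_mult_left_zero)
      finally show ?thesis .
    qed
    ultimately show "(\<lambda>k. a c k * (w - of_real c) ^ k) sums F w" by (simp add: sums_def F_def)
  qed
  have "F field_differentiable (at z)" if z: "0 < Re z" for z
  proof -
    text \<open>    \<comment> \<open>Every \<open>c > \<bar>z\<bar>\<^sup>2 / (2 Re z)\<close> puts \<open>z\<close> into the disc of radius \<open>c\<close> around \<open>c\<close>.\<close>\<close>
define c where "c = (norm z)\<^sup>2 / Re z"
    have n: "0 < (norm z)\<^sup>2" using z by auto
    then have c: "0 < c" using z by (simp add: c_def)
    have "(norm (z - of_real c))\<^sup>2 = (norm z)\<^sup>2 - 2 * c * Re z + c\<^sup>2"
      unfolding cmod_power2 by (simp add: power2_eq_square algebra_simps)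
    also have "2 * c * Re z = 2 * (norm z)\<^sup>2" using z by (simp add: c_def)
    also have "(norm z)\<^sup>2 - 2 * (norm z)\<^sup>2 + c\<^sup>2 < c\<^sup>2" using n by linarith
    finally have "norm (z - of_real c) < c" using c by (simp add: power_less_imp_less_base)
    then have "z \<in> ball (of_real c) c" by (simp add: dist_norm norm_minus_commute)
    then show ?thesis using F_ball[OF c] holomorphic_on_imp_differentiable_at by blast
  qed
  then have "F holomorphic_on {z. 0 < Re z}"
    unfolding holomorphic_on_def by (blast intro: field_differentiable_at_within)
  then show ?thesis by (simp only: F_def[abs_def])
qed

text \<open>Two holomorphic functions that agree on the positive reals agree on the open half-plane; the
boundary is reached along \<open>z + 1/n\<close>.\<close>
lemma laplace_transform_continuation:
  assumes Z[measurable]: "Z \<in> borel_measurable M" and nonneg: "AE \<omega> in M. 0 \<le> Z \<omega>"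
    and holo: "f holomorphic_on {z. 0 < Re z}" and cont: "continuous_on {z. 0 \<le> Re z} f"
    and real: "\<And>k. 0 < k \<Longrightarrow> expectation (\<lambda>\<omega>. exp (- k * Z \<omega>)) = g k"
              "\<And>k. 0 < k \<Longrightarrow> f (of_real k) = of_real (g k)"
    and z: "0 \<le> Re z"
  shows "expectation (\<lambda>\<omega>. exp (- z * complex_of_real (Z \<omega>))) = f z"
proof -
  define F where "F z = expectation (\<lambda>\<omega>. exp (- z * complex_of_real (Z \<omega>)))" for z
  have inner: "F z = f z" if "0 < Re z" for z
  proof -
    have "F z - f z = 0"
    proof (rule analytic_continuation[where S = "{z. 0 < Re z}" and U = "of_real ` {0<..}" and \<xi> = 1 and f = "\<lambda>z. F z - f z"])
      show "(\<lambda>z. F z - f z) holomorphic_on {z. 0 < Re z}"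
        unfolding F_def by (intro holomorphic_on_diff holomorphic_laplace_transform Z nonneg holo)
      show "open {z. 0 < Re z}" by (rule open_halfspace_Re_gt)
      show "connected {z. 0 < Re z}" by (intro convex_connected convex_halfspace_Re_gt)
      show "(1::complex) islimpt of_real ` {0<..}"
        unfolding islimpt_approachable
      proof (intro allI impI)
        fix e :: real assume "0 < e"
        moreover have "complex_of_real (1 + e / 2) - 1 = of_real (e / 2)" by simp
        then have "dist (complex_of_real (1 + e / 2)) 1 = \<bar>e / 2\<bar>"
          unfolding dist_norm by (simp only: norm_of_real)
        ultimately show "\<exists>x'\<in>complex_of_real ` {0<..}. x' \<noteq> 1 \<and> dist x' 1 < e"
          by (intro bexI[of _ "of_real (1 + e / 2)"]) (auto simp del: of_real_add)
      qed
      fix y :: complex assume "y \<in> of_real ` {0<..}"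
      then obtain k where k: "0 < k" "y = of_real k" by auto
      have "F y = expectation (\<lambda>\<omega>. complex_of_real (exp (- k * Z \<omega>)))"
        unfolding F_def k(2) by (simp add: exp_of_real[symmetric])
      then show "F y - f y = 0" using real[OF k(1)] by (simp add: k(2))
    qed (use that in auto)
    then show ?thesis by simp
  qed
  have approach: "(\<lambda>n. z + of_real (1 / real (Suc n))) \<longlonglongrightarrow> z"
    using tendsto_add[OF tendsto_const tendsto_of_real[OF LIMSEQ_Suc[OF lim_1_over_n]], of z] by simp
  have "(\<lambda>n. F (z + of_real (1 / real (Suc n)))) \<longlonglongrightarrow> F z"
    unfolding F_def
  proof (rule integral_dominated_convergence[where w = "\<lambda>_. 1"])
    show "AE \<omega> in M. (\<lambda>n. exp (- (z + of_real (1 / real (Suc n))) * complex_of_real (Z \<omega>))) \<longlonglongrightarrow>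
        exp (- z * complex_of_real (Z \<omega>))"
      by (intro AE_I2 tendsto_intros approach)
    show "AE \<omega> in M. norm (exp (- (z + of_real (1 / real (Suc n))) * complex_of_real (Z \<omega>))) \<le> 1" for n
      using nonneg
    proof eventually_elim
      case (elim \<omega>)
      then have "0 \<le> (Re z + 1 / real (Suc n)) * Z \<omega>" using z by simp
      moreover have "norm (exp (- (z + of_real (1 / real (Suc n))) * complex_of_real (Z \<omega>))) =
          exp (- ((Re z + 1 / real (Suc n)) * Z \<omega>))"
        unfolding norm_exp_eq_Re by (simp add: left_diff_distrib distrib_right)
      ultimately show ?case by simp
    qed
  qed auto
  moreover have "F (z + of_real (1 / real (Suc n))) = f (z + of_real (1 / real (Suc n)))" for n
    using z by (intro inner) (simp add: add_nonneg_pos)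
  moreover have "(\<lambda>n. f (z + of_real (1 / real (Suc n)))) \<longlonglongrightarrow> f z"
    by (rule continuous_on_tendsto_compose[OF cont approach]) (use z in \<open>auto intro!: always_eventually\<close>)
  ultimately show ?thesis using LIMSEQ_unique F_def by simp
qed

end

lemma continuous_on_powr_right_half_plane:
  assumes "0 < \<beta>"
  shows "continuous_on {z. 0 \<le> Re z} (\<lambda>z. z powr complex_of_real \<beta>)"
  using assms by (intro continuous_on_powr_complex continuous_intros) auto

text \<open>For \<open>\<beta> \<le> 1\<close> the power contracts the argument, so the right half-plane is mapped into itself.\<close>
lemma Re_powr_nonneg:
  assumes "0 \<le> Re z" "0 < \<beta>" "\<beta> \<le> 1"
  shows "0 \<le> Re (z powr complex_of_real \<beta>)"
proof (cases "z = 0")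
  case False
  then have im: "\<bar>Im (Ln z)\<bar> \<le> pi / 2" using assms(1) Re_Ln_pos_le by blast
  have "\<bar>\<beta> * Im (Ln z)\<bar> \<le> 1 * (pi / 2)"
    unfolding abs_mult using assms(2,3) im by (intro mult_mono) auto
  then have "0 \<le> cos (\<beta> * Im (Ln z))" by (intro cos_ge_zero) auto
  then show ?thesis using False by (simp add: powr_def Re_exp)
qed simp

lemma Re_Ln_nonneg:
  assumes "1 \<le> Re z"
  shows "0 \<le> Re (Ln z)"
proof -
  have "1 \<le> norm z" using assms complex_Re_le_cmod[of z] by linarith
  moreover have "z \<noteq> 0" using assms by auto
  ultimately show ?thesis by simp
qed

section \<open>Transforms of the component processes\<close>

context prob_space
begin

lemma stable_laplace_transform:
  assumes A: "stable_subordinator \<beta> A" and \<beta>: "0 < \<beta>" and t: "0 \<le> t" and z: "0 \<le> Re z"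
  shows "expectation (\<lambda>\<omega>. exp (- z * complex_of_real (A t \<omega>))) = exp (- (of_real t * z powr of_real \<beta>))"
proof (rule laplace_transform_continuation[where f = "\<lambda>z. exp (- (of_real t * z powr of_real \<beta>))", OF _ _ _ _ _ _ z])
  have "subordinator A" using A by (simp add: stable_subordinator_def)
  from nonneg_subordinator[OF this t] show "A t \<in> borel_measurable M" "AE \<omega> in M. 0 \<le> A t \<omega>" by auto
  show "(\<lambda>z. exp (- (complex_of_real t * z powr of_real \<beta>))) holomorphic_on {z. 0 < Re z}"
    by (intro holomorphic_intros) (auto simp: complex_nonpos_Reals_iff)
  show "continuous_on {z. 0 \<le> Re z} (\<lambda>z. exp (- (complex_of_real t * z powr of_real \<beta>)))"
    by (intro continuous_intros continuous_on_powr_right_half_plane \<beta>)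
  show "expectation (\<lambda>\<omega>. exp (- k * A t \<omega>)) = exp (- (k powr \<beta>) * t)" if "0 < k" for k
    using A t that by (simp add: stable_subordinator_def)
  show "exp (- (complex_of_real t * complex_of_real k powr of_real \<beta>)) = of_real (exp (- (k powr \<beta>) * t))"
    if "0 < k" for k
    using that by (simp add: powr_of_real exp_of_real[symmetric] mult.commute)
qed

text \<open>The substitution \<open>x \<mapsto> (b + k) x\<close> in the Gamma integral turns it into the integral of
\<open>exp (- k x)\<close> against the Gamma density, up to the constant \<open>(b + k)\<^sup>s \<Gamma>(s) / b\<^sup>s\<close>.\<close>
lemma gamma_laplace_transform_real:
  assumes G: "gamma_subordinator b G" and b: "0 < b" and s: "0 < s" and k: "0 < k"
  shows "expectation (\<lambda>\<omega>. exp (- k * G s \<omega>)) = exp (- s * ln (1 + k / b))"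
proof -
  let ?d = "\<lambda>x. b powr s / Gamma s * x powr (s - 1) * exp (- b * x) * indicator {0..} x"
  have D: "distributed M lborel (G s) (\<lambda>x. ennreal (?d x))"
    using G s by (simp add: gamma_subordinator_def)
  have [measurable]: "G s \<in> borel_measurable M" using distributed_measurable[OF D] by simp
  have Gamma_pos: "0 < Gamma s" using s by (rule Gamma_real_pos)
  have "ennreal (Gamma s) = (\<integral>\<^sup>+x. ennreal (indicator {0..} x * x powr (s - 1) / exp x) \<partial>lborel)"
    by (rule Gamma_conv_nn_integral_real[OF s])
  also have "\<dots> = ennreal \<bar>b + k\<bar> * (\<integral>\<^sup>+x. ennreal (indicator {0..} (0 + (b + k) * x) * (0 + (b + k) * x) powr (s - 1) / exp (0 + (b + k) * x)) \<partial>lborel)"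
    using b k by (intro nn_integral_real_affine) auto
  also have "\<dots> = (\<integral>\<^sup>+x. ennreal ((b + k) powr s * Gamma s / b powr s) * (ennreal (?d x) * ennreal (exp (- k * x))) \<partial>lborel)"
  proof (subst nn_integral_cmult[symmetric], measurable, rule nn_integral_cong)
    fix x :: real
    show "ennreal \<bar>b + k\<bar> * ennreal (indicator {0..} (0 + (b + k) * x) * (0 + (b + k) * x) powr (s - 1) / exp (0 + (b + k) * x)) =
      ennreal ((b + k) powr s * Gamma s / b powr s) * (ennreal (?d x) * ennreal (exp (- k * x)))"
    proof (cases "0 \<le> x")
      case True
      have "(b + k) * (((b + k) * x) powr (s - 1) / exp ((b + k) * x)) =
          ((b + k) * (b + k) powr (s - 1)) * (x powr (s - 1) / exp ((b + k) * x))"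
        using True b k by (simp only: powr_mult) simp
      also have "(b + k) * (b + k) powr (s - 1) = (b + k) powr s"
        using b k by (simp add: powr_mult_base)
      also have "x powr (s - 1) / exp ((b + k) * x) = x powr (s - 1) * (exp (- b * x) * exp (- k * x))"
        by (simp add: exp_add[symmetric] exp_minus[symmetric] divide_inverse algebra_simps)
      also have "(b + k) powr s * (x powr (s - 1) * (exp (- b * x) * exp (- k * x))) =
          (b + k) powr s * Gamma s / b powr s * (?d x * exp (- k * x))"
        using True Gamma_pos b by simp
      finally show ?thesis using True b k Gamma_pos
        by (simp add: ennreal_mult'[symmetric] less_imp_le del: ennreal_plus)
    next
      case False
      then show ?thesis using b k by (simp add: zero_le_mult_iff)
    qed
  qed
  also have "\<dots> = ennreal ((b + k) powr s * Gamma s / b powr s) * (\<integral>\<^sup>+x. ennreal (?d x) * ennreal (exp (- k * x)) \<partial>lborel)"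
    by (rule nn_integral_cmult) measurable
  also have "(\<integral>\<^sup>+x. ennreal (?d x) * ennreal (exp (- k * x)) \<partial>lborel) = (\<integral>\<^sup>+\<omega>. ennreal (exp (- k * G s \<omega>)) \<partial>M)"
    by (rule distributed_nn_integral[OF D]) measurable
  also have "\<dots> = ennreal (expectation (\<lambda>\<omega>. exp (- k * G s \<omega>)))"
  proof (rule nn_integral_eq_integral)
    have "subordinator G" using G by (simp add: gamma_subordinator_def)
    from nonneg_subordinator(2)[OF this, of s] s have "AE \<omega> in M. norm (exp (- k * G s \<omega>)) \<le> 1"
      using k by (auto elim!: eventually_mono)
    then show "integrable M (\<lambda>\<omega>. exp (- k * G s \<omega>))" by (rule integrable_const_bound) measurable
  qed simp
  finally have "Gamma s = (b + k) powr s * Gamma s / b powr s * expectation (\<lambda>\<omega>. exp (- k * G s \<omega>))"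
    using Gamma_pos b k by (simp add: ennreal_mult'[symmetric] integral_nonneg_AE ennreal_inj)
  then have "expectation (\<lambda>\<omega>. exp (- k * G s \<omega>)) = b powr s / (b + k) powr s"
    using Gamma_pos b k by (simp add: field_simps)
  also have "\<dots> = exp (- s * ln (1 + k / b))"
  proof -
    have "1 + k / b = (b + k) / b" using b by (simp add: field_simps)
    then show ?thesis using b k by (simp add: powr_def ln_div exp_diff[symmetric] algebra_simps)
  qed
  finally show ?thesis .
qed

lemma gamma_laplace_transform:
  assumes G: "gamma_subordinator b G" and b: "0 < b" and s: "0 \<le> s" and z: "0 \<le> Re z"
  shows "expectation (\<lambda>\<omega>. exp (- z * complex_of_real (G s \<omega>))) = exp (- (of_real s * Ln (1 + z / of_real b)))"
proof (cases "s = 0")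
  case True
  have L: "levy_process G" using G by (simp add: gamma_subordinator_def subordinator_def)
  then have [measurable]: "G 0 \<in> borel_measurable M" by (simp add: levy_process_def)
  have "expectation (\<lambda>\<omega>. exp (- z * complex_of_real (G 0 \<omega>))) = expectation (\<lambda>\<omega>. 1)"
  proof (rule integral_cong_AE)
    have "AE \<omega> in M. G 0 \<omega> = 0" using L by (simp add: levy_process_def)
    then show "AE \<omega> in M. exp (- z * complex_of_real (G 0 \<omega>)) = 1" by eventually_elim simp
  qed measurable
  then show ?thesis using True by (simp add: prob_space)
next
  case False
  then have s: "0 < s" using s by simp
  have slit: "1 + w / of_real b \<notin> \<real>\<^sub>\<le>\<^sub>0" if "0 \<le> Re w" for w
    using that b by (auto simp: complex_nonpos_Reals_iff not_le intro!: add_pos_nonneg)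
  show ?thesis
  proof (rule laplace_transform_continuation[where f = "\<lambda>z. exp (- (of_real s * Ln (1 + z / of_real b)))", OF _ _ _ _ _ _ z])
    have "subordinator G" using G by (simp add: gamma_subordinator_def)
    from nonneg_subordinator[OF this, of s] s show "G s \<in> borel_measurable M" "AE \<omega> in M. 0 \<le> G s \<omega>" by auto
    show "(\<lambda>z. exp (- (complex_of_real s * Ln (1 + z / of_real b)))) holomorphic_on {z. 0 < Re z}"
      using b by (intro holomorphic_intros) (use b slit in \<open>auto simp: less_imp_le\<close>)
    show "continuous_on {z. 0 \<le> Re z} (\<lambda>z. exp (- (complex_of_real s * Ln (1 + z / of_real b))))"
      using b by (intro continuous_intros) (use b slit in \<open>auto simp: less_imp_le\<close>)
    show "expectation (\<lambda>\<omega>. exp (- k * G s \<omega>)) = exp (- s * ln (1 + k / b))" if "0 < k" for k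
      by (rule gamma_laplace_transform_real[OF G b s that])
    show "exp (- (complex_of_real s * Ln (1 + of_real k / of_real b))) = of_real (exp (- s * ln (1 + k / b)))"
      if "0 < k" for k
    proof -
      have "Ln (1 + of_real k / of_real b) = Ln (of_real (1 + k / b))" by simp
      also have "\<dots> = of_real (ln (1 + k / b))" using that b by (intro Ln_of_real) (simp add: add_pos_pos)
      finally show ?thesis by (simp add: exp_of_real[symmetric])
    qed
  qed
qed

lemma brownian_char:
  assumes B: "brownian_motion B" and s: "0 \<le> s"
  shows "expectation (\<lambda>\<omega>. exp (\<i> * of_real u * of_real (B s \<omega>))) = exp (- (of_real s * ((of_real u)\<^sup>2 / 2)))"
proof (cases "s = 0")
  case True
  have L: "levy_process B" using B by (simp add: brownian_motion_def)
  then have [measurable]: "B 0 \<in> borel_measurable M" by (simp add: levy_process_def)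
  have "expectation (\<lambda>\<omega>. exp (\<i> * of_real u * of_real (B 0 \<omega>))) = expectation (\<lambda>\<omega>. 1 :: complex)"
  proof (rule integral_cong_AE)
    have "AE \<omega> in M. B 0 \<omega> = 0" using L by (simp add: levy_process_def)
    then show "AE \<omega> in M. exp (\<i> * of_real u * of_real (B 0 \<omega>)) = 1" by eventually_elim simp
  qed measurable
  then show ?thesis using True by (simp add: prob_space)
next
  case False
  then have s: "0 < s" using s by simp
  let ?W = "\<lambda>\<omega>. B s \<omega> / sqrt s"
  have "distributed M lborel (B s) (normal_density 0 (sqrt s))"
    using B s by (simp add: brownian_motion_def)
  then have D: "distributed M lborel ?W std_normal_density"
    using normal_standard_normal_convert[of "sqrt s" "B s" 0] s by simp
  have [measurable]: "?W \<in> borel_measurable M" using distributed_measurable[OF D] by simp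
  have "expectation (\<lambda>\<omega>. exp (\<i> * of_real u * of_real (B s \<omega>))) = expectation (\<lambda>\<omega>. iexp (u * sqrt s * ?W \<omega>))"
    using s by (simp add: mult.assoc)
  also have "\<dots> = (\<integral>x. iexp (u * sqrt s * x) \<partial>distr M lborel ?W)"
    by (subst integral_distr) auto
  also have "\<dots> = char std_normal_distribution (u * sqrt s)"
    unfolding distributed_distr_eq_density[OF D] char_def by simp
  also have "\<dots> = exp (- (of_real s * ((of_real u)\<^sup>2 / 2)))"
  proof -
    have "(u * sqrt s)\<^sup>2 = s * u\<^sup>2" using s by (simp add: power_mult_distrib)
    then have "(complex_of_real u * of_real (sqrt s))\<^sup>2 = of_real s * (of_real u)\<^sup>2"
      by (metis of_real_mult of_real_power)
    then show ?thesis by (simp add: char_std_normal_distribution exp_of_real[symmetric])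
  qed
  finally show ?thesis .
qed

text \<open>The prescribed probabilities sum to one, hence \<open>N s\<close> is almost surely a natural number and the
expectation is the sum over its values.\<close>
lemma poisson_char:
  assumes N: "poisson_process r N" and r: "0 \<le> r" and s: "0 \<le> s"
  shows "expectation (\<lambda>\<omega>. exp (\<i> * of_real u * of_real (N s \<omega>))) = exp (- (of_real s * (of_real r * (1 - exp (\<i> * of_real u)))))"
proof -
  let ?e = "exp (\<i> * complex_of_real u)"
  have [measurable]: "N s \<in> borel_measurable M" using N s by (simp add: poisson_process_def levy_process_def)
  define E where "E n = {\<omega>\<in>space M. N s \<omega> = real n}" for n :: nat
  have E[measurable]: "E n \<in> events" for n unfolding E_def by measurable
  have pE: "prob (E n) = (r * s) ^ n / fact n * exp (- r * s)" for n
    using N s unfolding E_def by (simp add: poisson_process_def)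
  have "(\<lambda>n. prob (E n)) sums prob (\<Union>n. E n)"
    by (rule finite_measure_UNION) (auto simp: disjoint_family_on_def E_def)
  moreover have "(\<lambda>n. prob (E n)) sums (exp (r * s) * exp (- r * s))"
    unfolding pE using sums_mult2[OF exp_converges[of "r * s"], of "exp (- r * s)"]
    by (simp add: divide_inverse mult.commute)
  ultimately have "prob (\<Union>n. E n) = 1" by (auto dest: sums_unique2 simp: exp_add[symmetric])
  then have "AE \<omega> in M. \<omega> \<in> (\<Union>n. E n)" by (intro prob_eq_1[THEN iffD1]) auto
  then have AE_E: "AE \<omega> in M. \<exists>n. \<omega> \<in> E n" by simp
  let ?f = "\<lambda>\<omega>. exp (\<i> * of_real u * of_real (N s \<omega>)) :: complex"
  let ?t = "\<lambda>n \<omega>. ?e ^ n * complex_of_real (indicator (E n) \<omega>)"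
  have part: "(\<Sum>n<m. ?t n \<omega>) = (if k < m then ?f \<omega> else 0)" if "\<omega> \<in> E k" for k m \<omega>
  proof -
    have "?t n \<omega> = (if n = k then ?f \<omega> else 0)" for n
      using that by (auto simp: E_def indicator_def exp_of_nat_mult[symmetric] mult_ac)
    then show ?thesis by simp
  qed
  have "(\<lambda>m. expectation (\<lambda>\<omega>. \<Sum>n<m. ?t n \<omega>)) \<longlonglongrightarrow> expectation ?f"
  proof (rule integral_dominated_convergence[where w = "\<lambda>_. 1"])
    show "AE \<omega> in M. (\<lambda>m. \<Sum>n<m. ?t n \<omega>) \<longlonglongrightarrow> ?f \<omega>"
      using AE_E
    proof eventually_elim
      case (elim \<omega>)
      then obtain k where k: "\<omega> \<in> E k" by blast
      show ?case unfolding part[OF k]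
        by (rule tendsto_eventually) (use eventually_gt_at_top[of k] in \<open>auto elim: eventually_mono\<close>)
    qed
    show "AE \<omega> in M. norm (\<Sum>n<m. ?t n \<omega>) \<le> 1" for m
      using AE_E
    proof eventually_elim
      case (elim \<omega>)
      then obtain k where k: "\<omega> \<in> E k" by blast
      show ?case unfolding part[OF k] by (simp add: norm_exp_eq_Re)
    qed
    show "(\<lambda>\<omega>. \<Sum>n<m. ?t n \<omega>) \<in> borel_measurable M" for m by measurable
  qed auto
  moreover have "expectation (\<lambda>\<omega>. \<Sum>n<m. ?t n \<omega>) = (\<Sum>n<m. ?e ^ n * of_real (prob (E n)))" for m
    by (subst Bochner_Integration.integral_sum)
      (auto simp: Int_absorb2 sets.sets_into_space[OF E] emeasure_eq_measure intro!: integrable_mult_right integrable_of_real integrable_real_indicator)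
  ultimately have "(\<lambda>n. ?e ^ n * of_real (prob (E n))) sums expectation ?f" by (simp add: sums_def)
  moreover have "(\<lambda>n. ?e ^ n * of_real (prob (E n))) sums (exp (of_real (r * s) * ?e) * of_real (exp (- r * s)))"
  proof -
    have "(\<lambda>n. ((of_real (r * s) * ?e) ^ n /\<^sub>R fact n) * of_real (exp (- r * s))) sums
        (exp (of_real (r * s) * ?e) * of_real (exp (- r * s)))"
      by (intro sums_mult2 exp_converges)
    moreover have "((of_real (r * s) * ?e) ^ n /\<^sub>R fact n) * of_real (exp (- r * s)) = ?e ^ n * of_real (prob (E n))" for n
      unfolding pE power_mult_distrib by (simp add: scaleR_conv_of_real divide_inverse power_mult_distrib mult_ac)
    ultimately show ?thesis by simp
  qed
  ultimately have "expectation ?f = exp (of_real (r * s) * ?e) * of_real (exp (- r * s))"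
    by (rule sums_unique2)
  also have "\<dots> = exp (of_real (r * s) * ?e + of_real (- r * s))"
    by (simp only: exp_add exp_of_real)
  also have "\<dots> = exp (- (of_real s * (of_real r * (1 - ?e))))" by (simp add: algebra_simps)
  finally show ?thesis .
qed

end

section \<open>Symbols of the subordinated processes\<close>

context prob_space
begin

lemma stable_subordination:
  fixes w :: "real \<Rightarrow> complex"
  assumes X: "levy_process X" and A: "stable_subordinator \<beta> A" and \<beta>: "0 < \<beta>"
    and ind: "indep_var path_space (sample_path X) path_space (sample_path A)"
    and char: "\<And>s u. 0 \<le> s \<Longrightarrow> expectation (\<lambda>\<omega>. exp (\<i> * of_real u * of_real (X s \<omega>))) = exp (- (of_real s * w u))"
    and w: "\<And>u. 0 \<le> Re (w u)" "continuous_on UNIV w" "w 0 = 0"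
    and eq: "AE \<omega> in M. \<forall>t\<ge>0. Z t \<omega> = subordinate X A t \<omega>"
  shows "prob_space.levy_process (completion M) Z \<and>
    (\<forall>t>0. \<forall>u. levy_symbol (completion M) Z t u = - (w u powr of_real \<beta>))"
proof (intro conjI allI impI)
  have sub: "subordinator A" using A by (simp add: stable_subordinator_def)
  show "prob_space.levy_process (completion M) Z"
    by (rule levy_process_completion[OF levy_process_subordinate[OF X sub ind] eq])
  fix t u :: real assume t: "0 < t"
  show "levy_symbol (completion M) Z t u = - (w u powr of_real \<beta>)"
  proof (rule levy_symbol_completion[where Y = "subordinate X A"])
    show "subordinate X A t \<in> borel_measurable M" using t by (intro subordinate_measurable X sub) simp
    show "AE \<omega> in M. Z t \<omega> = subordinate X A t \<omega>" using eq by eventually_elim (use t in simp)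
    show "expectation (\<lambda>\<omega>. exp (\<i> * of_real v * of_real (subordinate X A t \<omega>))) = exp (- (of_real t * w v powr of_real \<beta>))" for v
    proof -
      have "expectation (\<lambda>\<omega>. exp (\<i> * of_real v * of_real (subordinate X A t \<omega>))) =
          expectation (\<lambda>\<omega>. exp (- (of_real (A t \<omega>) * w v)))"
        using t by (intro expectation_subordinate[OF X sub ind, where h = "\<lambda>s. exp (- (of_real s * w v))"] char)
          (auto simp: norm_exp_eq_Re)
      also have "\<dots> = exp (- (of_real t * w v powr of_real \<beta>))"
        using stable_laplace_transform[OF A \<beta> _ w(1), of t v] t by (simp add: mult.commute)
      finally show ?thesis .
    qed
    have "continuous_on UNIV ((\<lambda>z. z powr of_real \<beta>) \<circ> w)"
      by (rule continuous_on_compose[OF w(2)], rule continuous_on_subset[OF continuous_on_powr_right_half_plane[OF \<beta>]])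
        (use w(1) in auto)
    then show "continuous_on UNIV (\<lambda>u. w u powr of_real \<beta>)" by (simp add: o_def)
  qed (use w t in auto)
qed

lemma indep_processes_pair:
  assumes "indep_processes [X, T]"
  shows "indep_var path_space (sample_path X) path_space (sample_path T)"
proof -
  have "indep_vars (\<lambda>_. path_space) (\<lambda>i. sample_path ([X, T] ! i)) {..<2}"
    using assms by (simp add: indep_processes_def sample_path_def[abs_def] numeral_2_eq_2)
  from indep_var_restrict[OF this, of "{0}" "{1}"]
  have "indep_var (PiM {0} (\<lambda>_. path_space)) (\<lambda>\<omega>. \<lambda>i\<in>{0}. sample_path ([X, T] ! i) \<omega>)
      (PiM {1} (\<lambda>_. path_space)) (\<lambda>\<omega>. \<lambda>i\<in>{1}. sample_path ([X, T] ! i) \<omega>)" by simp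
  from indep_var_compose[OF this, of "\<lambda>h. h 0" path_space "\<lambda>h. h 1" path_space]
  show ?thesis by (simp add: o_def)
qed

text \<open>Regrouping of the three independent paths; the composition of the first two is a measurable
function of their paths because it is built from \<open>path_at\<close>.\<close>
lemma indep_processes_triple:
  assumes "indep_processes [X, T, A]"
  shows "indep_var path_space (sample_path X) path_space (sample_path T)"
    "indep_var path_space (sample_path (subordinate X T)) path_space (sample_path A)"
proof -
  have ind: "indep_vars (\<lambda>_. path_space) (\<lambda>i. sample_path ([X, T, A] ! i)) {..<3}"
    using assms by (simp add: indep_processes_def sample_path_def[abs_def] numeral_3_eq_3)
  from indep_var_restrict[OF this, of "{0}" "{1}"]
  have "indep_var (PiM {0} (\<lambda>_. path_space)) (\<lambda>\<omega>. \<lambda>i\<in>{0}. sample_path ([X, T, A] ! i) \<omega>)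
      (PiM {1} (\<lambda>_. path_space)) (\<lambda>\<omega>. \<lambda>i\<in>{1}. sample_path ([X, T, A] ! i) \<omega>)" by simp
  from indep_var_compose[OF this, of "\<lambda>h. h 0" path_space "\<lambda>h. h 1" path_space]
  show "indep_var path_space (sample_path X) path_space (sample_path T)" by (simp add: o_def)
  let ?P = "PiM {0, 1::nat} (\<lambda>_. path_space)"
  let ?F = "\<lambda>h :: nat \<Rightarrow> real \<Rightarrow> real. \<lambda>t\<in>{0..}. path_at (h 0) (h 1 t)"
  have F: "?F \<in> ?P \<rightarrow>\<^sub>M path_space"
  proof (rule measurable_restrict)
    fix t :: real assume t: "t \<in> {0..}"
    have "(\<lambda>h. h 1) \<in> ?P \<rightarrow>\<^sub>M path_space" by (rule measurable_component_singleton) simp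
    from measurable_compose[OF this measurable_component_singleton[OF t]]
    have "(\<lambda>h. h 1 t) \<in> borel_measurable ?P" .
    then show "(\<lambda>h. path_at (h 0) (h 1 t)) \<in> borel_measurable ?P"
      by (intro measurable_path_at measurable_component_singleton) auto
  qed
  from indep_var_restrict[OF ind, of "{0, 1}" "{2}"]
  have "indep_var ?P (\<lambda>\<omega>. \<lambda>i\<in>{0, 1}. sample_path ([X, T, A] ! i) \<omega>)
      (PiM {2} (\<lambda>_. path_space)) (\<lambda>\<omega>. \<lambda>i\<in>{2}. sample_path ([X, T, A] ! i) \<omega>)" by simp
  from indep_var_compose[OF this F, of "\<lambda>h. h 2" path_space]
  have "indep_var path_space (\<lambda>\<omega>. \<lambda>t\<in>{0..}. path_at (sample_path X \<omega>) (sample_path T \<omega> t)) path_space (sample_path A)"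
    by (simp add: o_def)
  also have "(\<lambda>\<omega>. \<lambda>t\<in>{0..}. path_at (sample_path X \<omega>) (sample_path T \<omega> t)) = sample_path (subordinate X T)"
    by (auto simp: sample_path_def subordinate_def fun_eq_iff)
  finally show "indep_var path_space (sample_path (subordinate X T)) path_space (sample_path A)" .
qed

text \<open>The time change is read as \<open>(X \<circ> G) \<circ> A\<close>. The first composition has exponent \<open>Ln (1 + z(u)/b)\<close>,
which again has nonnegative real part, so that the stable time change applies to it.\<close>
lemma gamma_stable_subordination:
  fixes z :: "real \<Rightarrow> complex"
  assumes X: "levy_process X" and G: "gamma_subordinator b G" and A: "stable_subordinator \<beta> A"
    and b: "0 < b" and \<beta>: "0 < \<beta>" and ind: "indep_processes [X, G, A]"
    and char: "\<And>s u. 0 \<le> s \<Longrightarrow> expectation (\<lambda>\<omega>. exp (\<i> * of_real u * of_real (X s \<omega>))) = exp (- (of_real s * z u))"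
    and z: "\<And>u. 0 \<le> Re (z u)" "continuous_on UNIV z" "z 0 = 0"
  shows "prob_space.levy_process (completion M) (time_change X (time_change G A)) \<and>
    (\<forall>t>0. \<forall>u. levy_symbol (completion M) (time_change X (time_change G A)) t u =
       - (Ln (1 + z u / of_real b) powr of_real \<beta>))"
proof (rule stable_subordination)
  note indep = indep_processes_triple[OF ind]
  have subG: "subordinator G" and subA: "subordinator A"
    using G A by (auto simp: gamma_subordinator_def stable_subordinator_def)
  show levy: "levy_process (subordinate X G)" by (rule levy_process_subordinate[OF X subG indep(1)])
  show "indep_var path_space (sample_path (subordinate X G)) path_space (sample_path A)" by (rule indep(2))
  show "expectation (\<lambda>\<omega>. exp (\<i> * of_real u * of_real (subordinate X G s \<omega>))) =
      exp (- (of_real s * Ln (1 + z u / of_real b)))" if s: "0 \<le> s" for s u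
  proof -
    have "expectation (\<lambda>\<omega>. exp (\<i> * of_real u * of_real (subordinate X G s \<omega>))) =
        expectation (\<lambda>\<omega>. exp (- (of_real (G s \<omega>) * z u)))"
      using s by (intro expectation_subordinate[OF X subG indep(1), where h = "\<lambda>r. exp (- (of_real r * z u))"] char)
        (auto simp: norm_exp_eq_Re)
    also have "\<dots> = exp (- (of_real s * Ln (1 + z u / of_real b)))"
      using gamma_laplace_transform[OF G b s z(1), of u] by (simp add: mult.commute)
    finally show ?thesis .
  qed
  have ge: "1 \<le> Re (1 + z u / of_real b)" for u using z(1)[of u] b by simp
  show "0 \<le> Re (Ln (1 + z u / of_real b))" for u by (rule Re_Ln_nonneg[OF ge])
  have "1 + z u / of_real b \<notin> \<real>\<^sub>\<le>\<^sub>0" for u using ge[of u] by (auto simp: complex_nonpos_Reals_iff)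
  then show "continuous_on UNIV (\<lambda>u. Ln (1 + z u / of_real b))"
    using b by (intro continuous_intros z(2)) auto
  show "Ln (1 + z 0 / of_real b) = 0" by (simp add: z(3))
  show "AE \<omega> in M. \<forall>t\<ge>0. time_change X (time_change G A) t \<omega> = subordinate (subordinate X G) A t \<omega>"
    using subordinate_AE_eq[OF X subG] subordinate_AE_eq[OF levy subA] subordinator_paths[OF subA]
    by eventually_elim (simp add: time_change_def)
qed (fact A \<beta>)+

lemma stable_gamma_subordination:
  assumes G: "gamma_subordinator b G" and A: "stable_subordinator \<beta> A"
    and b: "0 < b" and \<beta>: "0 < \<beta>" and ind: "indep_processes [G, A]"
  shows "prob_space.levy_process (completion M) (time_change G A) \<and>
    (\<forall>t>0. \<forall>u. levy_symbol (completion M) (time_change G A) t u =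
       - (Ln (1 - \<i> * of_real u / of_real b) powr of_real \<beta>))"
proof (rule stable_subordination)
  have subA: "subordinator A" using A by (simp add: stable_subordinator_def)
  show levy: "levy_process G" using G by (simp add: gamma_subordinator_def subordinator_def)
  show "indep_var path_space (sample_path G) path_space (sample_path A)" by (rule indep_processes_pair[OF ind])
  show "expectation (\<lambda>\<omega>. exp (\<i> * of_real u * of_real (G s \<omega>))) =
      exp (- (of_real s * Ln (1 - \<i> * of_real u / of_real b)))" if "0 \<le> s" for s u
    using gamma_laplace_transform[OF G b that, of "- \<i> * of_real u"] by simp
  have ge: "1 \<le> Re (1 - \<i> * of_real u / of_real b)" for u using b by simp
  show "0 \<le> Re (Ln (1 - \<i> * of_real u / of_real b))" for u by (rule Re_Ln_nonneg[OF ge])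
  have "1 - \<i> * of_real u / of_real b \<notin> \<real>\<^sub>\<le>\<^sub>0" for u using ge[of u] by (auto simp: complex_nonpos_Reals_iff)
  then show "continuous_on UNIV (\<lambda>u. Ln (1 - \<i> * of_real u / of_real b))"
    using b by (intro continuous_intros) auto
  show "AE \<omega> in M. \<forall>t\<ge>0. time_change G A t \<omega> = subordinate G A t \<omega>"
    using subordinate_AE_eq[OF levy subA] by eventually_elim (simp add: time_change_def)
qed (use A \<beta> in auto)

end

theorem mainTheorem8:
  fixes M :: "'a measure" and \<nu> b \<alpha> p :: real
  assumes "prob_space M"
    and "\<nu> > 1" and "b > 0" and "0 < \<alpha>" and "\<alpha> \<le> 1" and "0 < p" and "p < 1"
  shows
    "(\<forall>G A.
        prob_space.gamma_subordinator M b G \<and>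
        prob_space.stable_subordinator M (1 / \<nu>) A \<and>
        prob_space.indep_processes M [G, A] \<longrightarrow>
        prob_space.levy_process (completion M) (time_change G A) \<and>
        (\<forall>t>0. \<forall>u. levy_symbol (completion M) (time_change G A) t u =
           - (Ln (1 - \<i> * of_real u / of_real b) powr of_real (1 / \<nu>)))) \<and>
     (\<forall>B G A.
        prob_space.brownian_motion M B \<and>
        prob_space.gamma_subordinator M 1 G \<and>
        prob_space.stable_subordinator M (1 / \<nu>) A \<and>
        prob_space.indep_processes M [B, G, A] \<longrightarrow>
        prob_space.levy_process (completion M) (time_change B (time_change G A)) \<and>
        (\<forall>t>0. \<forall>u. levy_symbol (completion M) (time_change B (time_change G A)) t u =
           - (Ln (1 + (of_real u)\<^sup>2 / 2) powr of_real (1 / \<nu>)))) \<and>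
     (\<forall>S G A.
        prob_space.stable_subordinator M \<alpha> S \<and>
        prob_space.gamma_subordinator M 1 G \<and>
        prob_space.stable_subordinator M (1 / \<nu>) A \<and>
        prob_space.indep_processes M [S, G, A] \<longrightarrow>
        prob_space.levy_process (completion M) (time_change S (time_change G A)) \<and>
        (\<forall>t>0. \<forall>u. levy_symbol (completion M) (time_change S (time_change G A)) t u =
           - (Ln (1 + (- \<i> * of_real u) powr of_real \<alpha>) powr of_real (1 / \<nu>)))) \<and>
     (\<forall>N G A.
        prob_space.poisson_process M 1 N \<and>
        prob_space.gamma_subordinator M (p / (1 - p)) G \<and>
        prob_space.stable_subordinator M (1 / \<nu>) A \<and>
        prob_space.indep_processes M [N, G, A] \<longrightarrow>
        prob_space.levy_process (completion M) (time_change N (time_change G A)) \<and>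
        (\<forall>t>0. \<forall>u. levy_symbol (completion M) (time_change N (time_change G A)) t u =
           - (Ln ((1 - (1 - of_real p) * exp (\<i> * of_real u)) / of_real p) powr of_real (1 / \<nu>))))"
proof -
  interpret prob_space M by fact
  have \<beta>: "0 < 1 / \<nu>" using \<open>\<nu> > 1\<close> by simp
  have i: "prob_space.levy_process (completion M) (time_change G A) \<and>
        (\<forall>t>0. \<forall>u. levy_symbol (completion M) (time_change G A) t u =
           - (Ln (1 - \<i> * of_real u / of_real b) powr of_real (1 / \<nu>)))"
    if "gamma_subordinator b G" "stable_subordinator (1 / \<nu>) A" "indep_processes [G, A]" for G A
    by (rule stable_gamma_subordination[OF that(1,2) \<open>b > 0\<close> \<beta> that(3)])
  have ii: "prob_space.levy_process (completion M) (time_change B (time_change G A)) \<and>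
        (\<forall>t>0. \<forall>u. levy_symbol (completion M) (time_change B (time_change G A)) t u =
           - (Ln (1 + (of_real u)\<^sup>2 / 2) powr of_real (1 / \<nu>)))"
    if "brownian_motion B" "gamma_subordinator 1 G" "stable_subordinator (1 / \<nu>) A" "indep_processes [B, G, A]" for B G A
  proof -
    have "levy_process B" using that(1) by (simp add: brownian_motion_def)
    from gamma_stable_subordination[OF this that(2,3) zero_less_one \<beta> that(4) brownian_char[OF that(1)]]
    show ?thesis by (simp add: continuous_intros flip: of_real_power)
  qed
  have iii: "prob_space.levy_process (completion M) (time_change S (time_change G A)) \<and>
        (\<forall>t>0. \<forall>u. levy_symbol (completion M) (time_change S (time_change G A)) t u =
           - (Ln (1 + (- \<i> * of_real u) powr of_real \<alpha>) powr of_real (1 / \<nu>)))"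
    if "stable_subordinator \<alpha> S" "gamma_subordinator 1 G" "stable_subordinator (1 / \<nu>) A" "indep_processes [S, G, A]" for S G A
  proof -
    let ?z = "\<lambda>u. (- \<i> * complex_of_real u) powr of_real \<alpha>"
    have levy: "levy_process S" using that(1) by (simp add: stable_subordinator_def subordinator_def)
    have char: "expectation (\<lambda>\<omega>. exp (\<i> * of_real u * of_real (S s \<omega>))) = exp (- (of_real s * ?z u))" if s: "0 \<le> s" for s u
      using stable_laplace_transform[OF \<open>stable_subordinator \<alpha> S\<close> \<open>0 < \<alpha>\<close> s, of "- \<i> * of_real u"] by simp
    have "0 \<le> Re (?z u)" for u using assms(4,5) by (intro Re_powr_nonneg) auto
    moreover have "continuous_on UNIV ?z"
      using \<open>0 < \<alpha>\<close> by (intro continuous_on_powr_complex continuous_intros) auto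
    ultimately show ?thesis
      using gamma_stable_subordination[OF levy that(2,3) zero_less_one \<beta> that(4) char] by simp
  qed
  have iv: "prob_space.levy_process (completion M) (time_change N (time_change G A)) \<and>
        (\<forall>t>0. \<forall>u. levy_symbol (completion M) (time_change N (time_change G A)) t u =
           - (Ln ((1 - (1 - of_real p) * exp (\<i> * of_real u)) / of_real p) powr of_real (1 / \<nu>)))"
    if "poisson_process 1 N" "gamma_subordinator (p / (1 - p)) G" "stable_subordinator (1 / \<nu>) A" "indep_processes [N, G, A]" for N G A
  proof -
    let ?z = "\<lambda>u. 1 - exp (\<i> * complex_of_real u)"
    have levy: "levy_process N" using that(1) by (simp add: poisson_process_def)
    have char: "expectation (\<lambda>\<omega>. exp (\<i> * of_real u * of_real (N s \<omega>))) = exp (- (of_real s * ?z u))" if s: "0 \<le> s" for s u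
      using poisson_char[OF \<open>poisson_process 1 N\<close> zero_le_one s, of u] by simp
    have b: "0 < p / (1 - p)" using assms(6,7) by simp
    have Re: "0 \<le> Re (?z u)" for u by (simp add: Re_exp)
    have cont: "continuous_on UNIV ?z" by (intro continuous_intros)
    have arg: "1 + ?z u / of_real (p / (1 - p)) = (1 - (1 - of_real p) * exp (\<i> * of_real u)) / of_real p" for u
    proof -
      have "complex_of_real p \<noteq> 0" "complex_of_real p \<noteq> 1" using assms(6,7) by simp_all
      then show ?thesis by (simp add: field_simps)
    qed
    show ?thesis
      using gamma_stable_subordination[OF levy that(2,3) b \<beta> that(4) char Re cont] unfolding arg by simp
  qed
  show ?thesis
    by (intro conjI; intro allI impI; elim conjE)
      ((rule i, assumption+) | (rule ii, assumption+) | (rule iii, assumption+) | (rule iv, assumption+))+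
qed

end
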